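(* Let $\epsilon\in\{1,-1\}$, let $g_0=(g_{0\,\mu\nu})$ be a constant, real, symmetric, invertible $2\times 2$ matrix, and let $\phi$ be a smooth real function of $(x^1,x^2)$ on an open set $U\subset\mathbb{R}^2$ whose graph $S_0=\{x^3=\phi(x^1,x^2)\}$ is a minimal surface in the three-dimensional flat space with metric $g_{0\,\mu\nu}dx^\mu dx^\nu+\epsilon (dx^3)^2$; explicitly, writing $(x,y)=(x^1,x^2)$, $k_1=g_{0\,11}$, $k_0=g_{0\,12}$, $k_2=g_{0\,22}$, $$[k_2+\epsilon\phi_{,y}^2]\phi_{,xx}-2[k_0+\epsilon\phi_{,x}\phi_{,y}]\phi_{,xy}+[k_1+\epsilon\phi_{,x}^2]\phi_{,yy}=0 .$$ Let $\rho=1+\epsilon\, g_0^{\mu\nu}\phi_{,\mu}\phi_{,\nu}$, $h_{\mu\nu}=g_{0\,\mu\nu}+\epsilon\phi_{,\mu}\phi_{,\nu}$, $g_{\mu\nu}=\rho^{-1/2}h_{\mu\nu}$, $w_1=k_1+\epsilon\phi_{,x}^2$, $w_2=k_2+\epsilon\phi_{,y}^2$, and assume $\rho>0$, $w_1>0$, $w_2>0$ on $U$. Let $n\ge 1$ be an integer, let $\epsilon_1,\dots,\epsilon_n\in\{1,-1\}$, and let $e_0,m_1,m_2,n_1,n_2$ be real constants with $$m_1+m_2=0,\qquad n_1+n_2=\frac{n-1}{2}.$$ Define $\Phi$ by $$e^{2\Phi}=e^{2\psi}\,w_1^{-2n_1}\,w_2^{-2n_2}\,\rho^{\,n_1+n_2},\qquad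 e^{2\psi}=e^{2e_0\phi}\,w_1^{-2m_1}\,w_2^{-2m_2}.$$ Then the $2N=2+2n$ dimensional (pseudo-)Riemannian metric $$ds^2=e^{2\Phi}g_{\alpha\beta}\,dx^\alpha dx^\beta+\epsilon_1 g_{\alpha\beta}\,dy_1^\alpha dy_1^\beta+\cdots+\epsilon_n g_{\alpha\beta}\,dy_n^\alpha dy_n^\beta$$ on $U\times\mathbb{R}^{2n}$, with coordinates $(x^\alpha,y_1^\alpha,\dots,y_n^\alpha)$, $\alpha=1,2$, is Ricci flat.
   Context: Greek indices take the values $1,2$; repeated indices are summed; a comma denotes partial differentiation with respect to $x^1,x^2$ ($\phi_{,\mu}=\partial_\mu\phi$). $g_0^{\mu\nu}$ denotes the components of the inverse matrix $g_0^{-1}$. The functions $\Phi$ and $g_{\alpha\beta}$ in the $2+2n$ dimensional metric depend only on $x=(x^1,x^2)$ and not on $y_1,\dots,y_n$. Ricci flat means that the Ricci tensor of the Levi-Civita connection vanishes identically. *)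

theory Defs
  imports "HOL-Analysis.Analysis"
begin

section \<open>Partial derivatives and smoothness\<close>

definition partial_deriv :: "'i::finite \<Rightarrow> (real ^ 'i \<Rightarrow> real) \<Rightarrow> real ^ 'i \<Rightarrow> real" where
  "partial_deriv i f x = deriv (\<lambda>t. f (x + t *\<^sub>R axis i 1)) 0"

primrec iterated_partial :: "'i::finite list \<Rightarrow> (real ^ 'i \<Rightarrow> real) \<Rightarrow> real ^ 'i \<Rightarrow> real" where
  "iterated_partial [] f = f"
| "iterated_partial (i # is) f = partial_deriv i (iterated_partial is f)"

text \<open>On an open set this is C-infinity: the iterated partial derivatives of all orders exist
  and, being differentiable, are continuous.\<close>

definition smooth_on :: "(real ^ 'i::finite) set \<Rightarrow> (real ^ 'i \<Rightarrow> real) \<Rightarrow> bool" where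
  "smooth_on S f \<longleftrightarrow> (\<forall>is. \<forall>x\<in>S. iterated_partial is f differentiable (at x))"


section \<open>Pseudo-Riemannian metrics in a coordinate domain\<close>

text \<open>A metric on an open subset of \<open>real ^ 'i\<close> is given by its matrix of components in the
  standard coordinates.\<close>

definition pseudo_riemannian_metric_on ::
  "(real ^ 'i::finite) set \<Rightarrow> (real ^ 'i \<Rightarrow> real ^ 'i ^ 'i) \<Rightarrow> bool" where
  "pseudo_riemannian_metric_on S G \<longleftrightarrow>
     (\<forall>a b. smooth_on S (\<lambda>p. G p $ a $ b)) \<and>
     (\<forall>p\<in>S. transpose (G p) = G p \<and> invertible (G p))"

definition christoffel ::
  "(real ^ 'i::finite \<Rightarrow> real ^ 'i ^ 'i) \<Rightarrow> 'i \<Rightarrow> 'i \<Rightarrow> 'i \<Rightarrow> real ^ 'i \<Rightarrow> real" where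
  "christoffel G c a b p =
     (1/2) * (\<Sum>d\<in>UNIV. matrix_inv (G p) $ c $ d *
        (partial_deriv a (\<lambda>q. G q $ b $ d) p + partial_deriv b (\<lambda>q. G q $ a $ d) p
           - partial_deriv d (\<lambda>q. G q $ a $ b) p))"

text \<open>\<open>riemann G d c a b\<close> is the component \<open>dx\<^sup>d (R(\<partial>\<^sub>a, \<partial>\<^sub>b) \<partial>\<^sub>c)\<close> with
  \<open>R(X, Y) = [\<nabla>\<^sub>X, \<nabla>\<^sub>Y] - \<nabla>\<^bsub>[X, Y]\<^esub>\<close> for the Levi-Civita connection.\<close>

definition riemann ::
  "(real ^ 'i::finite \<Rightarrow> real ^ 'i ^ 'i) \<Rightarrow> 'i \<Rightarrow> 'i \<Rightarrow> 'i \<Rightarrow> 'i \<Rightarrow> real ^ 'i \<Rightarrow> real" where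
  "riemann G d c a b p =
     partial_deriv a (christoffel G d b c) p - partial_deriv b (christoffel G d a c) p
     + (\<Sum>e\<in>UNIV. christoffel G d a e p * christoffel G e b c p
                  - christoffel G d b e p * christoffel G e a c p)"

definition ricci ::
  "(real ^ 'i::finite \<Rightarrow> real ^ 'i ^ 'i) \<Rightarrow> 'i \<Rightarrow> 'i \<Rightarrow> real ^ 'i \<Rightarrow> real" where
  "ricci G c b p = (\<Sum>a\<in>UNIV. riemann G a c a b p)"

definition ricci_flat_on ::
  "(real ^ 'i::finite) set \<Rightarrow> (real ^ 'i \<Rightarrow> real ^ 'i ^ 'i) \<Rightarrow> bool" where
  "ricci_flat_on S G \<longleftrightarrow> (\<forall>p\<in>S. \<forall>a b. ricci G a b p = 0)"


section \<open>Minimal graphs in flat three-space\<close>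

text \<open>The minimal surface equation for the graph \<open>x\<^sup>3 = \<phi>(x\<^sup>1, x\<^sup>2)\<close> in flat space with metric
  \<open>g0\<^sub>\<mu>\<^sub>\<nu> dx\<^sup>\<mu> dx\<^sup>\<nu> + \<epsilon> (dx\<^sup>3)\<^sup>2\<close>.  It is \<open>h\<^sup>\<mu>\<^sup>\<nu> \<partial>\<^sub>\<mu>\<partial>\<^sub>\<nu>\<phi> = 0\<close>, i.e. vanishing mean
  curvature, multiplied by \<open>det h\<close>, where \<open>h\<close> is the induced metric defined below.\<close>

definition minimal_graph_on ::
  "(real ^ 2) set \<Rightarrow> real ^ 2 ^ 2 \<Rightarrow> real \<Rightarrow> (real ^ 2 \<Rightarrow> real) \<Rightarrow> bool" where
  "minimal_graph_on U g0 \<epsilon> \<phi> \<longleftrightarrow>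
     (\<forall>x\<in>U.
        (g0 $ 2 $ 2 + \<epsilon> * (partial_deriv 2 \<phi> x)\<^sup>2) * partial_deriv 1 (partial_deriv 1 \<phi>) x
        - 2 * (g0 $ 1 $ 2 + \<epsilon> * partial_deriv 1 \<phi> x * partial_deriv 2 \<phi> x)
            * partial_deriv 2 (partial_deriv 1 \<phi>) x
        + (g0 $ 1 $ 1 + \<epsilon> * (partial_deriv 1 \<phi> x)\<^sup>2) * partial_deriv 2 (partial_deriv 2 \<phi>) x
        = 0)"

definition graph_rho :: "real ^ 2 ^ 2 \<Rightarrow> real \<Rightarrow> (real ^ 2 \<Rightarrow> real) \<Rightarrow> real ^ 2 \<Rightarrow> real" where
  "graph_rho g0 \<epsilon> \<phi> x =
     1 + \<epsilon> * (\<Sum>\<mu>\<in>UNIV. \<Sum>\<nu>\<in>UNIV.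
                 matrix_inv g0 $ \<mu> $ \<nu> * partial_deriv \<mu> \<phi> x * partial_deriv \<nu> \<phi> x)"

definition induced_metric ::
  "real ^ 2 ^ 2 \<Rightarrow> real \<Rightarrow> (real ^ 2 \<Rightarrow> real) \<Rightarrow> real ^ 2 \<Rightarrow> real ^ 2 ^ 2" where
  "induced_metric g0 \<epsilon> \<phi> x =
     (\<chi> \<mu> \<nu>. g0 $ \<mu> $ \<nu> + \<epsilon> * partial_deriv \<mu> \<phi> x * partial_deriv \<nu> \<phi> x)"

definition rescaled_metric ::
  "real ^ 2 ^ 2 \<Rightarrow> real \<Rightarrow> (real ^ 2 \<Rightarrow> real) \<Rightarrow> real ^ 2 \<Rightarrow> real ^ 2 ^ 2" where
  "rescaled_metric g0 \<epsilon> \<phi> x =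
     (graph_rho g0 \<epsilon> \<phi> x powr (-1/2)) *\<^sub>R induced_metric g0 \<epsilon> \<phi> x"

definition graph_w :: "real ^ 2 ^ 2 \<Rightarrow> real \<Rightarrow> (real ^ 2 \<Rightarrow> real) \<Rightarrow> 2 \<Rightarrow> real ^ 2 \<Rightarrow> real" where
  "graph_w g0 \<epsilon> \<phi> \<mu> x = g0 $ \<mu> $ \<mu> + \<epsilon> * (partial_deriv \<mu> \<phi> x)\<^sup>2"


section \<open>The metric in dimension 2 + 2n\<close>

text \<open>Coordinates are indexed by \<open>'n option \<times> 2\<close> with \<open>n = CARD('n)\<close>:
  \<open>(None, \<alpha>)\<close> stands for \<open>x\<^sup>\<alpha>\<close> and \<open>(Some i, \<alpha>)\<close> for \<open>y\<^sub>i\<^sup>\<alpha>\<close>.\<close>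

definition base_point :: "real ^ ('n::finite option \<times> 2) \<Rightarrow> real ^ 2" where
  "base_point p = (\<chi> \<alpha>. p $ (None, \<alpha>))"

definition total_domain :: "(real ^ 2) set \<Rightarrow> (real ^ ('n::finite option \<times> 2)) set" where
  "total_domain U = {p. base_point p \<in> U}"

definition total_metric ::
  "(real ^ 2 \<Rightarrow> real) \<Rightarrow> (real ^ 2 \<Rightarrow> real ^ 2 ^ 2) \<Rightarrow> ('n::finite \<Rightarrow> real) \<Rightarrow>
   real ^ ('n option \<times> 2) \<Rightarrow> real ^ ('n option \<times> 2) ^ ('n option \<times> 2)" where
  "total_metric \<Phi> g \<epsilon>s p =
     (\<chi> a b. if fst a = fst b
             then (case fst a of None \<Rightarrow> exp (2 * \<Phi> (base_point p)) | Some i \<Rightarrow> \<epsilon>s i)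
                    * g (base_point p) $ snd a $ snd b
             else 0)"

end

theory Submission
  imports Defs
begin

text \<open>
  Since \<open>det g = det g0\<close> is constant, the minimal surface equation says exactly that the
  coordinates are harmonic, i.e. \<open>\<partial>\<^sub>\<mu> g\<^sup>\<mu>\<^sup>\<nu> = 0\<close>, which in two dimensions means that
  \<open>u\<^sub>\<alpha>\<^sub>\<beta>\<^sub>\<gamma> = \<partial>\<^sub>\<alpha> g\<^sub>\<beta>\<^sub>\<gamma>\<close> is totally symmetric: \<open>g\<close> is locally the Hessian of a solution of a
  Monge-Ampere equation.  Its Christoffel symbols are then \<open>T = g\<^sup>-\<^sup>1 u / 2\<close>; they are trace-free, and
  differentiating \<open>det g\<close> twice gives \<open>div T = 2 T\<cdot>T\<close>, where \<open>(T\<cdot>T)\<^sub>\<beta>\<^sub>\<gamma> = T\<^sup>\<alpha>\<^sub>\<beta>\<^sub>\<epsilon> T\<^sup>\<epsilon>\<^sub>\<alpha>\<^sub>\<gamma>\<close>.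

  With \<open>L = 2 \<Phi>\<close> the fibre components of the Ricci tensor are multiples of
  \<open>div T - 2 T\<cdot>T = 0\<close>, the mixed ones vanish, and the base components are
  \<open>(1 - n) T\<cdot>T - g \<Delta>L / 2\<close>.  Here \<open>T\<cdot>T\<close> is a multiple of \<open>g\<close>, and
  \<open>L = 2 e0 \<phi> - 2 (m1 + n1) ln g\<^sub>1\<^sub>1 - 2 (m2 + n2) ln g\<^sub>2\<^sub>2\<close>, where \<open>\<Delta>\<phi> = 0\<close> by minimality and
  \<open>\<Delta> ln g\<^sub>1\<^sub>1 = \<Delta> ln g\<^sub>2\<^sub>2\<close> is the scalar curvature, i.e. the trace of \<open>T\<cdot>T\<close>; the coefficients sum to
  \<open>-(n - 1)\<close>, so the two terms cancel.
\<close>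

section \<open>Partial derivatives and smooth functions\<close>

lemma differentiable_imp_has_partial_deriv:
  fixes f :: "real ^ 'i::finite \<Rightarrow> real"
  assumes "f differentiable (at x)"
  shows "((\<lambda>t. f (x + t *\<^sub>R axis i 1)) has_real_derivative partial_deriv i f x) (at 0)"
proof -
  have "(\<lambda>t. f (x + t *\<^sub>R axis i 1)) differentiable (at (0::real))"
    by (rule differentiable_compose[where f = f]) (use assms in \<open>auto intro!: derivative_intros\<close>)
  then show ?thesis
    unfolding partial_deriv_def
    using DERIV_deriv_iff_real_differentiable by blast
qed

lemma partial_deriv_eqI:
  "((\<lambda>t. f (x + t *\<^sub>R axis i 1)) has_real_derivative D) (at 0) \<Longrightarrow> partial_deriv i f x = D"
  unfolding partial_deriv_def by (rule DERIV_imp_deriv)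

lemma partial_deriv_has_derivative:
  fixes f :: "real ^ 'i::finite \<Rightarrow> real"
  assumes "(f has_derivative A) (at x)"
  shows "partial_deriv i f x = A (axis i 1)"
proof (rule partial_deriv_eqI)
  have lin: "linear A"
    using assms has_derivative_linear by blast
  have "((\<lambda>t. f (x + t *\<^sub>R axis i 1)) has_derivative (\<lambda>t. A (t *\<^sub>R axis i 1))) (at (0::real))"
    by (rule has_derivative_compose[where g = f])
       (use assms in \<open>auto intro!: derivative_eq_intros\<close>)
  then show "((\<lambda>t. f (x + t *\<^sub>R axis i 1)) has_real_derivative A (axis i 1)) (at 0)"
    by (simp add: has_field_derivative_def linear_scale[OF lin] mult_commute_abs)
qed

lemma partial_deriv_const [simp]: "partial_deriv i (\<lambda>x. c) x = 0"
  by (simp add: partial_deriv_def)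

lemma partial_deriv_cong:
  fixes f :: "real ^ 'i::finite \<Rightarrow> real"
  assumes "open S" "x \<in> S" "\<And>y. y \<in> S \<Longrightarrow> f y = g y"
  shows "partial_deriv i f x = partial_deriv i g x"
proof -
  have "((\<lambda>t. x + t *\<^sub>R axis i 1) \<longlongrightarrow> x + 0 *\<^sub>R axis i 1) (nhds (0::real))"
    by (intro tendsto_intros filterlim_ident)
  then have "((\<lambda>t. x + t *\<^sub>R axis i 1) \<longlongrightarrow> x) (nhds (0::real))"
    by simp
  then have "eventually (\<lambda>t. x + t *\<^sub>R axis i 1 \<in> S) (nhds (0::real))"
    using assms(1,2) topological_tendstoD by blast
  then have "eventually (\<lambda>t. f (x + t *\<^sub>R axis i 1) = g (x + t *\<^sub>R axis i 1)) (nhds (0::real))"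
    by eventually_elim (rule assms(3))
  then show ?thesis
    unfolding partial_deriv_def by (rule deriv_cong_ev) simp
qed

section \<open>Symmetry of second partial derivatives\<close>

text \<open>The mean value theorem along \<open>v\<close> reduces the second difference to an
  increment of \<open>partial_deriv i f\<close> in direction \<open>w\<close>. Differentiability of
  that partial derivative at the single point \<open>x\<close> then gives the limit. This is the
  analytic core of the symmetry of mixed partial derivatives.\<close>

lemma second_difference_tendsto:
  fixes f :: "real ^ 'i::finite \<Rightarrow> real" and i j :: 'i
  assumes "open S" "x \<in> S" and f: "\<And>y. y \<in> S \<Longrightarrow> f differentiable (at y)"
    and Di: "partial_deriv i f differentiable (at x)"
  defines "v \<equiv> axis i 1" and "w \<equiv> axis j 1"
  shows "((\<lambda>h. (f (x + h *\<^sub>R v + h *\<^sub>R w) - f (x + h *\<^sub>R v) - f (x + h *\<^sub>R w) + f x) / h\<^sup>2)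
            \<longlongrightarrow> partial_deriv j (partial_deriv i f) x) (at_right 0)"
proof (rule tendstoI)
  fix e :: real
  assume "e > 0"
  obtain A where A: "(partial_deriv i f has_derivative A) (at x)"
    using Di differentiable_def by blast
  then have Aw: "partial_deriv j (partial_deriv i f) x = A w"
    unfolding w_def by (rule partial_deriv_has_derivative)
  have lin: "linear A"
    using A has_derivative_linear by blast
  \<comment> \<open>The errors collected below add up to \<open>e' * (2 * z + h)\<close> with
    \<open>z < h\<close>, hence to less than \<open>e' * (4 * h) = e * h\<close>.\<close>
  define e' where "e' = e / 4"
  have "e' > 0"
    using \<open>e > 0\<close> by (simp add: e'_def)
  obtain d where "d > 0" and d: "\<And>y. norm (y - x) < d \<Longrightarrow>
      norm (partial_deriv i f y - partial_deriv i f x - A (y - x)) \<le> e' * norm (y - x)"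
    using A \<open>e' > 0\<close> unfolding has_derivative_at_alt by blast
  obtain d' where "d' > 0" and d': "ball x d' \<subseteq> S"
    using \<open>open S\<close> \<open>x \<in> S\<close> openE by blast
  \<comment> \<open>A corner displacement has norm at most \<open>s + t <= 2 * h\<close>, so halving
    keeps the whole parallelogram inside both balls.\<close>
  define r where "r = min d d' / 2"
  have "r > 0"
    using \<open>d > 0\<close> \<open>d' > 0\<close> by (simp add: r_def)
  have nv: "norm v = 1" "norm w = 1"
    by (simp_all add: v_def w_def)
  have "dist ((f (x + h *\<^sub>R v + h *\<^sub>R w) - f (x + h *\<^sub>R v) - f (x + h *\<^sub>R w) + f x) / h\<^sup>2) (A w) < e"
    if h: "0 < h" "h < r" for h
  proof -
    have small: "norm (s *\<^sub>R v + t *\<^sub>R w) < min d d'" "norm (s *\<^sub>R v + t *\<^sub>R w) \<le> s + t"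
      if "0 \<le> s" "s \<le> h" "0 \<le> t" "t \<le> h" for s t
    proof -
      have "norm (s *\<^sub>R v + t *\<^sub>R w) \<le> norm (s *\<^sub>R v) + norm (t *\<^sub>R w)"
        by (rule norm_triangle_ineq)
      also have "\<dots> = s + t"
        using that by (simp add: nv)
      finally show "norm (s *\<^sub>R v + t *\<^sub>R w) \<le> s + t" .
      also have "s + t < min d d'"
        using that h by (simp add: r_def)
      finally show "norm (s *\<^sub>R v + t *\<^sub>R w) < min d d'" .
    qed
    have inS: "x + s *\<^sub>R v + t *\<^sub>R w \<in> S" if "0 \<le> s" "s \<le> h" "0 \<le> t" "t \<le> h" for s t
    proof -
      have "dist (x + (s *\<^sub>R v + t *\<^sub>R w)) x < d'"
        using small(1)[OF that] by (simp add: dist_norm)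
      then show ?thesis
        using d' by (auto simp: add.assoc dist_commute)
    qed
    \<comment> \<open>The second difference is \<open>F h - F 0\<close>, to which the mean value
      theorem applies.\<close>
    define F where "F t = f (x + t *\<^sub>R v + h *\<^sub>R w) - f (x + t *\<^sub>R v)" for t
    have line: "((\<lambda>t. f (y + t *\<^sub>R v)) has_real_derivative partial_deriv i f (y + t *\<^sub>R v)) (at t)"
      if "y + t *\<^sub>R v \<in> S" for y t
    proof -
      have "((\<lambda>s. f ((y + t *\<^sub>R v) + s *\<^sub>R v)) has_real_derivative partial_deriv i f (y + t *\<^sub>R v)) (at 0)"
        unfolding v_def
        by (rule differentiable_imp_has_partial_deriv) (use f that in \<open>auto simp: v_def\<close>)
      then have "((\<lambda>s. f (y + s *\<^sub>R v)) has_real_derivative partial_deriv i f (y + t *\<^sub>R v)) (at (0 + t))"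
        by (subst DERIV_shift) (simp add: algebra_simps)
      then show ?thesis
        by simp
    qed
    have F': "(F has_real_derivative partial_deriv i f (x + t *\<^sub>R v + h *\<^sub>R w) - partial_deriv i f (x + t *\<^sub>R v)) (at t)"
      if "0 \<le> t" "t \<le> h" for t
    proof -
      have "((\<lambda>t. f ((x + h *\<^sub>R w) + t *\<^sub>R v)) has_real_derivative
              partial_deriv i f ((x + h *\<^sub>R w) + t *\<^sub>R v)) (at t)"
        by (rule line) (use inS[of t h] that h in \<open>simp add: algebra_simps\<close>)
      moreover have "((\<lambda>t. f (x + t *\<^sub>R v)) has_real_derivative partial_deriv i f (x + t *\<^sub>R v)) (at t)"
        by (rule line) (use inS[of t 0] that h in simp)
      ultimately show ?thesis
        unfolding F_def by (simp add: DERIV_diff add.assoc add.commute add.left_commute)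
    qed
    obtain z where z: "0 < z" "z < h" and
      Fz: "F h - F 0 = (h - 0) * (partial_deriv i f (x + z *\<^sub>R v + h *\<^sub>R w) - partial_deriv i f (x + z *\<^sub>R v))"
      using MVT2[OF h(1) F'] by blast
    have 1: "\<bar>partial_deriv i f (x + z *\<^sub>R v + h *\<^sub>R w) - partial_deriv i f x - A (z *\<^sub>R v + h *\<^sub>R w)\<bar>
               \<le> e' * (z + h)"
    proof -
      have "\<bar>partial_deriv i f (x + z *\<^sub>R v + h *\<^sub>R w) - partial_deriv i f x - A (z *\<^sub>R v + h *\<^sub>R w)\<bar>
               \<le> e' * norm (z *\<^sub>R v + h *\<^sub>R w)"
        using d[of "x + z *\<^sub>R v + h *\<^sub>R w"] small(1)[of z h] z h by (simp add: add.assoc)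
      also have "\<dots> \<le> e' * (z + h)"
        using small(2)[of z h] z h \<open>e' > 0\<close> by simp
      finally show ?thesis .
    qed
    have 2: "\<bar>partial_deriv i f (x + z *\<^sub>R v) - partial_deriv i f x - A (z *\<^sub>R v)\<bar> \<le> e' * z"
      using d[of "x + z *\<^sub>R v"] small(1)[of z 0] z h by (simp add: nv)
    have "A (z *\<^sub>R v + h *\<^sub>R w) = A (z *\<^sub>R v) + h * A w"
      by (simp add: linear_add[OF lin] linear_scale[OF lin])
    then have "\<bar>(partial_deriv i f (x + z *\<^sub>R v + h *\<^sub>R w) - partial_deriv i f (x + z *\<^sub>R v)) - h * A w\<bar>
        \<le> e' * (z + h) + e' * z"
      using 1 2 by linarith
    also have "\<dots> = e' * (2 * z + h)"
      by (simp add: algebra_simps)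
    also have "\<dots> < e' * (4 * h)"
      using z \<open>e' > 0\<close> h by (intro mult_strict_left_mono) auto
    also have "\<dots> = e * h"
      by (simp add: e'_def)
    finally have "\<bar>(partial_deriv i f (x + z *\<^sub>R v + h *\<^sub>R w) - partial_deriv i f (x + z *\<^sub>R v)) - h * A w\<bar> / h < e"
      using h by (simp add: divide_simps)
    then have "\<bar>((partial_deriv i f (x + z *\<^sub>R v + h *\<^sub>R w) - partial_deriv i f (x + z *\<^sub>R v)) - h * A w) / h\<bar> < e"
      using h by simp
    also have "((partial_deriv i f (x + z *\<^sub>R v + h *\<^sub>R w) - partial_deriv i f (x + z *\<^sub>R v)) - h * A w) / h
        = (F h - F 0) / h\<^sup>2 - A w"
      unfolding Fz using h by (simp add: field_simps power2_eq_square)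
    also have "F h - F 0 = f (x + h *\<^sub>R v + h *\<^sub>R w) - f (x + h *\<^sub>R v) - f (x + h *\<^sub>R w) + f x"
      by (simp add: F_def)
    finally show ?thesis
      by (simp add: dist_real_def)
  qed
  then show "\<forall>\<^sub>F h in at_right 0. dist ((f (x + h *\<^sub>R v + h *\<^sub>R w) - f (x + h *\<^sub>R v) - f (x + h *\<^sub>R w) + f x) / h\<^sup>2)
          (partial_deriv j (partial_deriv i f) x) < e"
    unfolding Aw eventually_at_right_field using \<open>r > 0\<close> by blast
qed

text \<open>Both mixed derivatives are limits of the same expression, since the second difference is
  symmetric in the two directions.\<close>

lemma partial_deriv_commute:
  fixes f :: "real ^ 'i::finite \<Rightarrow> real"
  assumes "open S" "x \<in> S" "\<And>y. y \<in> S \<Longrightarrow> f differentiable (at y)"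
    and "partial_deriv i f differentiable (at x)" "partial_deriv j f differentiable (at x)"
  shows "partial_deriv i (partial_deriv j f) x = partial_deriv j (partial_deriv i f) x"
proof (rule tendsto_unique[OF trivial_limit_at_right_real])
  show "((\<lambda>h. (f (x + h *\<^sub>R axis j 1 + h *\<^sub>R axis i 1) - f (x + h *\<^sub>R axis j 1) - f (x + h *\<^sub>R axis i 1) + f x) / h\<^sup>2)
            \<longlongrightarrow> partial_deriv i (partial_deriv j f) x) (at_right 0)"
    by (rule second_difference_tendsto) (use assms in auto)
  have "((\<lambda>h. (f (x + h *\<^sub>R axis i 1 + h *\<^sub>R axis j 1) - f (x + h *\<^sub>R axis i 1) - f (x + h *\<^sub>R axis j 1) + f x) / h\<^sup>2)
            \<longlongrightarrow> partial_deriv j (partial_deriv i f) x) (at_right 0)"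
    by (rule second_difference_tendsto) (use assms in auto)
  then show "((\<lambda>h. (f (x + h *\<^sub>R axis j 1 + h *\<^sub>R axis i 1) - f (x + h *\<^sub>R axis j 1) - f (x + h *\<^sub>R axis i 1) + f x) / h\<^sup>2)
            \<longlongrightarrow> partial_deriv j (partial_deriv i f) x) (at_right 0)"
    by (simp add: algebra_simps)
qed

section \<open>Closure properties of smooth functions\<close>

lemma iterated_partial_snoc:
  "iterated_partial (is @ [i]) f = iterated_partial is (partial_deriv i f)"
  by (induction "is") simp_all

lemma smooth_on_imp_differentiable:
  "smooth_on S f \<Longrightarrow> x \<in> S \<Longrightarrow> f differentiable (at x)"
  unfolding smooth_on_def using iterated_partial.simps(1) by metis

lemma smooth_on_partial_deriv:
  "smooth_on S f \<Longrightarrow> smooth_on S (partial_deriv i f)"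
  unfolding smooth_on_def iterated_partial_snoc[symmetric] by blast

lemma differentiable_cong_open:
  fixes f :: "real ^ 'i::finite \<Rightarrow> real"
  assumes "open S" "x \<in> S" "\<And>y. y \<in> S \<Longrightarrow> f y = g y" "g differentiable (at x)"
  shows "f differentiable (at x)"
proof -
  obtain A where "(g has_derivative A) (at x)"
    using assms(4) differentiable_def by blast
  then have "(f has_derivative A) (at x)"
    by (rule has_derivative_transform_within_open[OF _ assms(1,2)]) (simp add: assms(3))
  then show ?thesis
    using differentiable_def by blast
qed

text \<open>A class of functions differentiable on \<open>S\<close> and closed under partial
  derivatives consists of smooth functions. Closure is asked only up to equality on
  \<open>S\<close>, which suffices because partial derivatives at points of an open set depend only
  on values there.\<close>

lemma smooth_on_coinduct:
  fixes f :: "real ^ 'i::finite \<Rightarrow> real"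
  assumes S: "open S" and "C f"
    and diff: "\<And>f x. C f \<Longrightarrow> x \<in> S \<Longrightarrow> f differentiable (at x)"
    and step: "\<And>f i. C f \<Longrightarrow> \<exists>g. C g \<and> (\<forall>x\<in>S. partial_deriv i f x = g x)"
  shows "smooth_on S f"
proof -
  have ex: "\<exists>g. C g \<and> (\<forall>x\<in>S. iterated_partial is f x = g x)" for "is"
  proof (induction "is")
    case Nil
    show ?case using \<open>C f\<close> by auto
  next
    case (Cons i "is")
    then obtain g where g: "C g" "\<forall>x\<in>S. iterated_partial is f x = g x"
      by blast
    obtain g' where g': "C g'" "\<forall>x\<in>S. partial_deriv i g x = g' x"
      using step[OF g(1)] by blast
    have "partial_deriv i (iterated_partial is f) x = partial_deriv i g x" if "x \<in> S" for x
      by (rule partial_deriv_cong[OF S that]) (use g in auto)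
    then show ?case
      using g' by auto
  qed
  show ?thesis
    unfolding smooth_on_def
  proof (intro allI ballI)
    fix "is" x
    assume "x \<in> S"
    obtain g where g: "C g" "\<forall>x\<in>S. iterated_partial is f x = g x"
      using ex by blast
    show "iterated_partial is f differentiable (at x)"
      by (rule differentiable_cong_open[OF S \<open>x \<in> S\<close>, of _ g])
         (use g diff \<open>x \<in> S\<close> in auto)
  qed
qed

text \<open>Coinduction with the class of all functions that agree on \<open>S\<close> with some
  smooth function.\<close>

lemma smooth_on_cong:
  assumes "open S" "\<And>x. x \<in> S \<Longrightarrow> f x = g x" "smooth_on S g"
  shows "smooth_on S f"
proof (rule smooth_on_coinduct[where C = "\<lambda>f. \<exists>g. smooth_on S g \<and> (\<forall>x\<in>S. f x = g x)"])
  show "f differentiable (at x)" if "\<exists>g. smooth_on S g \<and> (\<forall>x\<in>S. f x = g x)" "x \<in> S" for f x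
    using that assms(1) by (metis differentiable_cong_open smooth_on_imp_differentiable)
  show "\<exists>g. (\<exists>h. smooth_on S h \<and> (\<forall>x\<in>S. g x = h x)) \<and> (\<forall>x\<in>S. partial_deriv i f x = g x)"
    if f: "\<exists>g. smooth_on S g \<and> (\<forall>x\<in>S. f x = g x)" for f i
  proof -
    obtain g where g: "smooth_on S g" "\<forall>x\<in>S. f x = g x"
      using f by blast
    then have "\<forall>x\<in>S. partial_deriv i f x = partial_deriv i g x"
      using partial_deriv_cong[OF assms(1)] by blast
    then show ?thesis
      using smooth_on_partial_deriv[OF g(1)] by blast
  qed
qed (use assms in auto)

lemma smooth_on_const: "smooth_on S (\<lambda>x. c)"
proof -
  have "\<exists>d. iterated_partial is (\<lambda>x. c) = (\<lambda>x. d)" for "is" :: "'a list"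
    by (induction "is") (auto simp: partial_deriv_def)
  then show ?thesis
    unfolding smooth_on_def by (metis differentiable_const)
qed

text \<open>A class closed under the algebraic operations whose partial derivatives stay in the class: by
  coinduction all closure properties of smoothness follow at once.\<close>

inductive smooth_gen :: "(real ^ 'i::finite) set \<Rightarrow> (real ^ 'i \<Rightarrow> real) \<Rightarrow> bool"
  for S where
  base: "smooth_on S f \<Longrightarrow> smooth_gen S f"
| add: "smooth_gen S f \<Longrightarrow> smooth_gen S g \<Longrightarrow> smooth_gen S (\<lambda>x. f x + g x)"
| mult: "smooth_gen S f \<Longrightarrow> smooth_gen S g \<Longrightarrow> smooth_gen S (\<lambda>x. f x * g x)"
| exp: "smooth_gen S f \<Longrightarrow> smooth_gen S (\<lambda>x. exp (f x))"
| powr: "smooth_gen S f \<Longrightarrow> (\<And>x. x \<in> S \<Longrightarrow> f x > 0) \<Longrightarrow> smooth_gen S (\<lambda>x. f x powr r)"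
| ln: "smooth_gen S f \<Longrightarrow> (\<And>x. x \<in> S \<Longrightarrow> f x > 0) \<Longrightarrow> smooth_gen S (\<lambda>x. ln (f x))"

lemma smooth_gen_differentiable:
  assumes "smooth_gen S f" "x \<in> S"
  shows "f differentiable (at x)"
  using assms
proof (induction rule: smooth_gen.induct)
  case (exp f)
  then have "exp \<circ> f differentiable at x"
    by (intro differentiable_chain_at)
       (auto intro!: field_differentiable_imp_differentiable field_differentiable_within_exp)
  then show ?case by (simp add: o_def)
next
  case (powr f r)
  then have "(\<lambda>y. y powr r) differentiable at (f x)"
    by (metis has_real_derivative_powr real_differentiable_def)
  with powr have "(\<lambda>y. y powr r) \<circ> f differentiable at x"
    by (intro differentiable_chain_at) auto
  then show ?case by (simp add: o_def)
next
  case (ln f)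
  then have "ln differentiable at (f x)"
    by (metis DERIV_ln real_differentiable_def)
  with ln have "ln \<circ> f differentiable at x"
    by (intro differentiable_chain_at) auto
  then show ?case by (simp add: o_def)
qed (auto intro: smooth_on_imp_differentiable differentiable_add differentiable_mult)

lemmas smooth_gen_has_partial_deriv =
  differentiable_imp_has_partial_deriv[OF smooth_gen_differentiable]

lemma smooth_gen_partial_deriv:
  assumes "smooth_gen S f"
  shows "\<exists>g. smooth_gen S g \<and> (\<forall>x\<in>S. partial_deriv i f x = g x)"
  using assms
proof (induction rule: smooth_gen.induct)
  case (base f)
  then show ?case
    using smooth_gen.base smooth_on_partial_deriv by blast
next
  case (add f g)
  then obtain f' g' where "smooth_gen S f'" "\<forall>x\<in>S. partial_deriv i f x = f' x"
    "smooth_gen S g'" "\<forall>x\<in>S. partial_deriv i g x = g' x" by blast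
  then show ?case using add.hyps
    by (intro exI[of _ "\<lambda>x. f' x + g' x"])
       (auto intro!: smooth_gen.add smooth_gen.mult smooth_gen.exp partial_deriv_eqI derivative_eq_intros smooth_gen_has_partial_deriv)
next
  case (mult f g)
  then obtain f' g' where "smooth_gen S f'" "\<forall>x\<in>S. partial_deriv i f x = f' x"
    "smooth_gen S g'" "\<forall>x\<in>S. partial_deriv i g x = g' x" by blast
  then show ?case using mult.hyps
    by (intro exI[of _ "\<lambda>x. f' x * g x + g' x * f x"])
       (auto intro!: smooth_gen.add smooth_gen.mult smooth_gen.exp partial_deriv_eqI derivative_eq_intros smooth_gen_has_partial_deriv)
next
  case (exp f)
  then obtain f' where "smooth_gen S f'" "\<forall>x\<in>S. partial_deriv i f x = f' x" by blast
  then show ?case using exp.hyps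
    by (intro exI[of _ "\<lambda>x. exp (f x) * f' x"])
       (auto intro!: smooth_gen.add smooth_gen.mult smooth_gen.exp partial_deriv_eqI derivative_eq_intros smooth_gen_has_partial_deriv)
next
  case (powr f r)
  then obtain f' where f': "smooth_gen S f'" "\<forall>x\<in>S. partial_deriv i f x = f' x" by blast
  have "partial_deriv i (\<lambda>x. f x powr r) x = r * (f x powr (r - 1) * f' x)" if "x \<in> S" for x
  proof (rule partial_deriv_eqI)
    show "((\<lambda>t. f (x + t *\<^sub>R axis i 1) powr r) has_real_derivative r * (f x powr (r - 1) * f' x)) (at 0)"
      using DERIV_chain2[OF has_real_derivative_powr[of "f (x + 0 *\<^sub>R axis i 1)" r]
          smooth_gen_has_partial_deriv[OF powr.hyps(1) that]]
        powr.hyps(2)[OF that] f'(2) that by (simp add: algebra_simps)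
  qed
  moreover have "smooth_gen S (\<lambda>x. r * (f x powr (r - 1) * f' x))"
    using f' powr.hyps
    by (intro smooth_gen.mult smooth_gen.powr smooth_gen.base[OF smooth_on_const]) auto
  ultimately show ?case by blast
next
  case (ln f)
  then obtain f' where f': "smooth_gen S f'" "\<forall>x\<in>S. partial_deriv i f x = f' x" by blast
  \<comment> \<open>Writing the reciprocal as a power keeps the derivative inside
    \<open>smooth_gen\<close>, which has no rule for quotients.\<close>
  have "partial_deriv i (\<lambda>x. ln (f x)) x = f x powr (-1) * f' x" if "x \<in> S" for x
  proof (rule partial_deriv_eqI)
    show "((\<lambda>t. ln (f (x + t *\<^sub>R axis i 1))) has_real_derivative f x powr (-1) * f' x) (at 0)"
      using DERIV_chain2[OF DERIV_ln[of "f (x + 0 *\<^sub>R axis i 1)"]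
          smooth_gen_has_partial_deriv[OF ln.hyps(1) that]]
        ln.hyps(2)[OF that] f'(2) that by (simp add: powr_minus)
  qed
  moreover have "smooth_gen S (\<lambda>x. f x powr (-1) * f' x)"
    using f' ln.hyps by (intro smooth_gen.mult smooth_gen.powr) auto
  ultimately show ?case by blast
qed

lemma smooth_gen_imp_smooth_on: "open S \<Longrightarrow> smooth_gen S f \<Longrightarrow> smooth_on S f"
  by (erule smooth_on_coinduct[where C = "smooth_gen S"])
     (auto intro: smooth_gen_differentiable smooth_gen_partial_deriv)

section \<open>Functions pulled back from the base\<close>

lemma base_point_shift_None:
  "base_point (p + t *\<^sub>R axis (None, \<alpha>) 1) = base_point p + t *\<^sub>R axis \<alpha> 1"
  by (simp add: base_point_def vec_eq_iff axis_def)

lemma base_point_shift_Some: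
  "base_point (p + t *\<^sub>R axis (Some i, \<alpha>) 1) = base_point p"
  by (simp add: base_point_def vec_eq_iff axis_def)

text \<open>Moving in a fibre direction leaves the base point fixed, and moving in a base direction
  shifts it by the same amount.\<close>

lemma partial_deriv_base_point:
  "partial_deriv A (\<lambda>p. f (base_point p)) p =
     (case fst A of None \<Rightarrow> partial_deriv (snd A) f (base_point p) | Some i \<Rightarrow> 0)"
  by (cases A; cases "fst A")
     (auto simp: partial_deriv_def base_point_shift_None base_point_shift_Some)

lemma bounded_linear_base_point: "bounded_linear (base_point :: real ^ ('n::finite option \<times> 2) \<Rightarrow> _)"
  unfolding linear_conv_bounded_linear[symmetric]
  by (rule linearI) (simp_all add: base_point_def vec_eq_iff)

lemma open_total_domain:
  "open U \<Longrightarrow> open (total_domain U :: (real ^ ('n::finite option \<times> 2)) set)"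
  unfolding total_domain_def
  using continuous_open_preimage[OF linear_continuous_on[OF bounded_linear_base_point], of UNIV U]
  by (simp add: vimage_def)

text \<open>Coinduction on pullbacks of smooth functions: a partial derivative of a pullback is
  again a pullback, of a partial derivative or of zero.\<close>

lemma smooth_on_base_point:
  fixes f :: "real ^ 2 \<Rightarrow> real"
  assumes "open U" "smooth_on U f"
  shows "smooth_on (total_domain U :: (real ^ ('n::finite option \<times> 2)) set) (\<lambda>p. f (base_point p))"
proof (rule smooth_on_coinduct[where C = "\<lambda>F. \<exists>f. smooth_on U f \<and> F = (\<lambda>p. f (base_point p))"])
  show "F differentiable (at p)" if F: "\<exists>f. smooth_on U f \<and> F = (\<lambda>p. f (base_point p))"
    and p: "p \<in> total_domain U" for F and p :: "real ^ ('n::finite option \<times> 2)"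
  proof -
    obtain f where f: "smooth_on U f" "F = f \<circ> base_point"
      using F by (auto simp: o_def)
    show ?thesis
      unfolding f(2)
      by (rule differentiable_chain_at)
         (use f p in \<open>auto simp: total_domain_def bounded_linear_imp_differentiable bounded_linear_base_point
             intro: smooth_on_imp_differentiable\<close>)
  qed
  show "\<exists>G. (\<exists>f. smooth_on U f \<and> G = (\<lambda>p. f (base_point p))) \<and>
      (\<forall>p\<in>total_domain U. partial_deriv A F p = G p)"
    if F: "\<exists>f. smooth_on U f \<and> F = (\<lambda>p. f (base_point p))"
    for F and A :: "'n option \<times> 2"
  proof -
    obtain f where f: "smooth_on U f" "F = (\<lambda>p. f (base_point p))"
      using F by blast
    have "smooth_on U (\<lambda>x. case fst A of None \<Rightarrow> partial_deriv (snd A) f x | Some i \<Rightarrow> 0)"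
      by (cases "fst A") (use f in \<open>auto intro: smooth_on_const smooth_on_partial_deriv\<close>)
    then show ?thesis
      unfolding f(2) partial_deriv_base_point by fastforce
  qed
qed (use assms open_total_domain in auto)

section \<open>Block metrics over a Hessian metric\<close>

lemma sum_option_times:
  fixes f :: "'n::finite option \<times> 'a::finite \<Rightarrow> real"
  shows "(\<Sum>d\<in>UNIV. f d) = (\<Sum>\<delta>\<in>UNIV. f (None, \<delta>)) + (\<Sum>i\<in>UNIV. \<Sum>\<delta>\<in>UNIV. f (Some i, \<delta>))"
proof -
  have "(\<Sum>d\<in>UNIV. f d) = (\<Sum>k\<in>UNIV. \<Sum>\<delta>\<in>UNIV. f (k, \<delta>))"
    by (simp add: sum.cartesian_product flip: UNIV_Times_UNIV)
  then show ?thesis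
    by (simp add: UNIV_option_conv sum.reindex)
qed

lemma sum_fst_eq:
  fixes f :: "'n::finite \<times> 'a::finite \<Rightarrow> real"
  shows "(\<Sum>d\<in>UNIV. if k = fst d then f d else 0) = (\<Sum>\<delta>\<in>UNIV. f (k, \<delta>))"
proof -
  have "(\<Sum>d\<in>UNIV. if k = fst d then f d else 0) = (\<Sum>i\<in>UNIV. \<Sum>\<delta>\<in>UNIV. if k = i then f (i, \<delta>) else 0)"
    by (simp add: sum.cartesian_product split_def cong: if_cong flip: UNIV_Times_UNIV)
  also have "\<dots> = (\<Sum>i\<in>UNIV. if k = i then \<Sum>\<delta>\<in>UNIV. f (i, \<delta>) else 0)"
    by (rule sum.cong) auto
  finally show ?thesis by simp
qed

text \<open>For square matrices a one-sided inverse is two-sided, and multiplying by it identifies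
  the inverse that \<open>matrix_inv\<close> chooses.\<close>

lemma matrix_inv_eqI:
  fixes A B :: "real ^ 'i::finite ^ 'i"
  assumes "A ** B = mat 1"
  shows "invertible A" "matrix_inv A = B"
proof -
  have BA: "B ** A = mat 1"
    using assms matrix_left_right_inverse by blast
  then show "invertible A"
    using assms invertible_def by blast
  have "A ** matrix_inv A = mat 1 \<and> matrix_inv A ** A = mat 1"
    unfolding matrix_inv_def by (rule someI) (use assms BA in blast)
  then have "matrix_inv A ** (A ** B) = B"
    by (simp add: matrix_mul_assoc)
  then show "matrix_inv A = B"
    by (simp add: assms matrix_mul_rid)
qed

lemma smooth_on_partial_deriv_commute:
  assumes "open S" "smooth_on S f" "x \<in> S"
  shows "partial_deriv i (partial_deriv j f) x = partial_deriv j (partial_deriv i f) x"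
  by (rule partial_deriv_commute[OF assms(1,3)])
     (use assms in \<open>auto intro: smooth_on_imp_differentiable smooth_on_partial_deriv\<close>)

lemma smooth_on_has_partial_deriv:
  assumes "smooth_on S f" "x \<in> S"
  shows "((\<lambda>t. f (x + t *\<^sub>R axis i 1)) has_real_derivative partial_deriv i f x) (at 0)"
  by (rule differentiable_imp_has_partial_deriv[OF smooth_on_imp_differentiable[OF assms]])

section \<open>Planar metrics of constant determinant with symmetric first derivatives\<close>

text \<open>The two Codazzi conditions together with \<open>g21\<close> say that the first
  derivatives of \<open>g\<close> are totally symmetric. \<open>L\<close> is the logarithm of the
  conformal factor on the base. \<open>g21\<close> is imposed at every point so that it can rewrite
  a function that is to be differentiated.\<close>

locale hessian_metric =
  fixes U :: "(real ^ 2) set" and g :: "real ^ 2 \<Rightarrow> real ^ 2 ^ 2" and L :: "real ^ 2 \<Rightarrow> real" and D :: real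
  assumes open_U: "open U"
    and smooth_g: "smooth_on U (\<lambda>x. g x $ \<alpha> $ \<beta>)"
    and smooth_L: "smooth_on U L"
    and g21: "g x $ 2 $ 1 = g x $ 1 $ 2"
    and det_g: "x \<in> U \<Longrightarrow> g x $ 1 $ 1 * g x $ 2 $ 2 - (g x $ 1 $ 2)\<^sup>2 = D"
    and D_nz: "D \<noteq> 0"
    and codazzi1: "x \<in> U \<Longrightarrow> partial_deriv 2 (\<lambda>x. g x $ 1 $ 1) x = partial_deriv 1 (\<lambda>x. g x $ 1 $ 2) x"
    and codazzi2: "x \<in> U \<Longrightarrow> partial_deriv 1 (\<lambda>x. g x $ 2 $ 2) x = partial_deriv 2 (\<lambda>x. g x $ 1 $ 2) x"
begin

text \<open>\<open>T\<close> and \<open>H\<close> are the Christoffel symbols of \<open>g\<close> and of the conformal metric \<open>exp L \<cdot> g\<close>, with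
  the upper index first; \<open>gi\<close> is \<open>g\<^sup>-\<^sup>1\<close> on \<open>U\<close>.\<close>

definition u :: "2 \<Rightarrow> 2 \<Rightarrow> 2 \<Rightarrow> real ^ 2 \<Rightarrow> real" where
  "u \<alpha> \<beta> \<gamma> = partial_deriv \<alpha> (\<lambda>x. g x $ \<beta> $ \<gamma>)"

definition gi :: "2 \<Rightarrow> 2 \<Rightarrow> real ^ 2 \<Rightarrow> real" where
  "gi \<alpha> \<beta> x = (if \<alpha> = \<beta> then (if \<alpha> = 1 then g x $ 2 $ 2 else g x $ 1 $ 1) else - g x $ 1 $ 2) / D"

definition T :: "2 \<Rightarrow> 2 \<Rightarrow> 2 \<Rightarrow> real ^ 2 \<Rightarrow> real" where
  "T \<gamma> \<alpha> \<beta> x = (1/2) * (\<Sum>\<delta>\<in>UNIV. gi \<gamma> \<delta> x * u \<alpha> \<beta> \<delta> x)"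

definition H :: "2 \<Rightarrow> 2 \<Rightarrow> 2 \<Rightarrow> real ^ 2 \<Rightarrow> real" where
  "H \<gamma> \<alpha> \<beta> x = T \<gamma> \<alpha> \<beta> x + (1/2) * ((if \<gamma> = \<beta> then partial_deriv \<alpha> L x else 0)
     + (if \<gamma> = \<alpha> then partial_deriv \<beta> L x else 0)
     - g x $ \<alpha> $ \<beta> * (\<Sum>\<delta>\<in>UNIV. gi \<gamma> \<delta> x * partial_deriv \<delta> L x))"

lemma g_sym: "g x $ \<alpha> $ \<beta> = g x $ \<beta> $ \<alpha>"
  using exhaust_2[of \<alpha>] exhaust_2[of \<beta>] g21 by auto

lemma u_sym23: "u \<alpha> \<beta> \<gamma> = u \<alpha> \<gamma> \<beta>"
  unfolding u_def by (subst g_sym) (rule refl)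

lemma u_sym12: "x \<in> U \<Longrightarrow> u \<alpha> \<beta> \<gamma> x = u \<beta> \<alpha> \<gamma> x"
  using exhaust_2[of \<alpha>] exhaust_2[of \<beta>] exhaust_2[of \<gamma>] codazzi1 codazzi2
  by (auto simp: u_def g21)

lemma gi_g: "x \<in> U \<Longrightarrow> (\<Sum>\<delta>\<in>UNIV. gi \<alpha> \<delta> x * g x $ \<delta> $ \<beta>) = (if \<alpha> = \<beta> then 1 else 0)"
  using exhaust_2[of \<alpha>] exhaust_2[of \<beta>] det_g[of x] D_nz
  by (auto simp: gi_def sum_2 g21 divide_simps power2_eq_square algebra_simps)

lemma gi_sym: "gi \<alpha> \<beta> x = gi \<beta> \<alpha> x"
  by (auto simp: gi_def)

end

section \<open>Inverse and Christoffel symbols of the block metric\<close>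

locale block_metric = hessian_metric U g L D
  for U :: "(real ^ 2) set" and g :: "real ^ 2 \<Rightarrow> real ^ 2 ^ 2" and L :: "real ^ 2 \<Rightarrow> real" and D :: real +
  fixes \<Phi> :: "real ^ 2 \<Rightarrow> real" and \<epsilon>s :: "'n::finite \<Rightarrow> real"
  assumes \<Phi>: "\<And>x. x \<in> U \<Longrightarrow> 2 * \<Phi> x = L x"
    and \<epsilon>s: "\<And>i. \<epsilon>s i * \<epsilon>s i = 1"
begin

abbreviation G :: "real ^ ('n option \<times> 2) \<Rightarrow> real ^ ('n option \<times> 2) ^ ('n option \<times> 2)" where
  "G \<equiv> total_metric \<Phi> g \<epsilon>s"

text \<open>The inverse of \<open>G\<close> over \<open>U\<close>, as \<open>G_Gi\<close> verifies.
  The sign \<open>\<epsilon>s i\<close> is its own inverse and therefore reappears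
  unchanged.\<close>

definition Gi :: "real ^ ('n option \<times> 2) \<Rightarrow> real ^ ('n option \<times> 2) ^ ('n option \<times> 2)" where
  "Gi p = (\<chi> a b. if fst a = fst b
     then (case fst a of None \<Rightarrow> exp (- L (base_point p)) | Some i \<Rightarrow> \<epsilon>s i)
            * gi (snd a) (snd b) (base_point p) else 0)"

lemma G_comp:
  assumes "p \<in> total_domain U"
  shows "G p $ a $ b = (if fst a = fst b
     then (case fst a of None \<Rightarrow> exp (L (base_point p)) | Some i \<Rightarrow> \<epsilon>s i)
            * g (base_point p) $ snd a $ snd b else 0)"
  using assms \<Phi>[of "base_point p"] by (simp add: total_metric_def total_domain_def cong: option.case_cong)

lemma G_Gi:
  assumes p: "p \<in> total_domain U"
  shows "G p ** Gi p = mat 1"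
proof -
  have U: "base_point p \<in> U"
    using p by (simp add: total_domain_def)
  let ?c = "\<lambda>k. case k of None \<Rightarrow> exp (L (base_point p)) | Some i \<Rightarrow> \<epsilon>s i"
  let ?d = "\<lambda>k. case k of None \<Rightarrow> exp (- L (base_point p)) | Some i \<Rightarrow> \<epsilon>s i"
  have cd: "?c k * ?d k = 1" for k
    by (cases k) (simp_all add: \<epsilon>s flip: exp_add)
  have "(\<Sum>d\<in>UNIV. G p $ a $ d * Gi p $ d $ b) = (if a = b then 1 else 0)" for a b
  proof -
    have "(\<Sum>d\<in>UNIV. G p $ a $ d * Gi p $ d $ b) =
      (\<Sum>d\<in>UNIV. if fst a = fst d then (if fst a = fst b then
          ?c (fst a) * ?d (fst a) * (gi (snd b) (snd d) (base_point p) * g (base_point p) $ snd d $ snd a) else 0) else 0)"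
      by (rule sum.cong) (auto simp: G_comp[OF p] Gi_def g_sym[of _ "snd a"] gi_sym[of "snd b"])
    also have "\<dots> = (if fst a = fst b then \<Sum>\<delta>\<in>UNIV. gi (snd b) \<delta> (base_point p) * g (base_point p) $ \<delta> $ snd a else 0)"
      unfolding sum_fst_eq cd by simp
    also have "\<dots> = (if a = b then 1 else 0)"
      unfolding gi_g[OF U] by (auto simp: prod_eq_iff)
    finally show ?thesis .
  qed
  then show ?thesis
    by (simp add: vec_eq_iff matrix_matrix_mult_def mat_def)
qed

lemma partial_G:
  assumes p: "p \<in> total_domain U"
  shows "partial_deriv (m, \<mu>) (\<lambda>q. G q $ (k, \<alpha>) $ (l, \<beta>)) p =
     (if m = None \<and> k = l then
       (case k of None \<Rightarrow> exp (L (base_point p)) *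
            (partial_deriv \<mu> L (base_point p) * g (base_point p) $ \<alpha> $ \<beta> + u \<mu> \<alpha> \<beta> (base_point p))
        | Some i \<Rightarrow> \<epsilon>s i * u \<mu> \<alpha> \<beta> (base_point p)) else 0)"
proof -
  have U: "base_point p \<in> U"
    using assms by (simp add: total_domain_def)
  define f where "f x = (if k = l
     then (case k of None \<Rightarrow> exp (L x) | Some i \<Rightarrow> \<epsilon>s i) * g x $ \<alpha> $ \<beta> else 0)" for x
  have "partial_deriv (m, \<mu>) (\<lambda>q. G q $ (k, \<alpha>) $ (l, \<beta>)) p = partial_deriv (m, \<mu>) (\<lambda>q. f (base_point q)) p"
    by (rule partial_deriv_cong[OF open_total_domain[OF open_U] p]) (simp add: G_comp f_def)
  also have "\<dots> = (case m of None \<Rightarrow> partial_deriv \<mu> f (base_point p) | Some i \<Rightarrow> 0)"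
    unfolding partial_deriv_base_point by (simp cong: option.case_cong)
  also have "partial_deriv \<mu> f (base_point p) = (if k = l then
       (case k of None \<Rightarrow> exp (L (base_point p)) *
            (partial_deriv \<mu> L (base_point p) * g (base_point p) $ \<alpha> $ \<beta> + u \<mu> \<alpha> \<beta> (base_point p))
        | Some i \<Rightarrow> \<epsilon>s i * u \<mu> \<alpha> \<beta> (base_point p)) else 0)"
    unfolding f_def u_def
    by (rule partial_deriv_eqI, cases k)
       (auto intro!: derivative_eq_intros smooth_on_has_partial_deriv[OF smooth_g U]
          smooth_on_has_partial_deriv[OF smooth_L U] simp: algebra_simps)
  finally show ?thesis
    by (auto split: option.split)
qed

lemma christoffel_G:
  assumes p: "p \<in> total_domain U"
  shows "christoffel G (k, \<gamma>) (l, \<alpha>) (m, \<beta>) p =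
    (1/2) * (\<Sum>\<delta>\<in>UNIV. (case k of None \<Rightarrow> exp (- L (base_point p)) | Some i \<Rightarrow> \<epsilon>s i) * gi \<gamma> \<delta> (base_point p) *
       (partial_deriv (l, \<alpha>) (\<lambda>q. G q $ (m, \<beta>) $ (k, \<delta>)) p + partial_deriv (m, \<beta>) (\<lambda>q. G q $ (l, \<alpha>) $ (k, \<delta>)) p
           - partial_deriv (k, \<delta>) (\<lambda>q. G q $ (l, \<alpha>) $ (m, \<beta>)) p))"
proof -
  let ?d = "case k of None \<Rightarrow> exp (- L (base_point p)) | Some i \<Rightarrow> \<epsilon>s i"
  let ?E = "\<lambda>d. partial_deriv (l, \<alpha>) (\<lambda>q. G q $ (m, \<beta>) $ d) p + partial_deriv (m, \<beta>) (\<lambda>q. G q $ (l, \<alpha>) $ d) p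
           - partial_deriv d (\<lambda>q. G q $ (l, \<alpha>) $ (m, \<beta>)) p"
  have "christoffel G (k, \<gamma>) (l, \<alpha>) (m, \<beta>) p =
      (1/2) * (\<Sum>d\<in>UNIV. if k = fst d then ?d * gi \<gamma> (snd d) (base_point p) * ?E d else 0)"
    unfolding christoffel_def matrix_inv_eqI(2)[OF G_Gi[OF p]]
    by (intro arg_cong[where f = "\<lambda>s. (1/2) * s"] sum.cong) (auto simp: Gi_def)
  then show ?thesis
    unfolding sum_fst_eq by simp
qed

text \<open>\<open>G\<close> is block diagonal and constant along the fibres, so the surviving
  symbols have no fibre index, or two fibre indices from the same factor. Total symmetry of
  \<open>u\<close> is what expresses all of the latter through \<open>T\<close>: the signs cancel
  when the upper index is a fibre index, and a factor \<open>- \<epsilon>s i * exp (- L x)\<close>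
  remains when it is a base index.\<close>

lemma christoffel_cases:
  assumes p: "p \<in> total_domain U"
  defines "x \<equiv> base_point p"
  shows
    "christoffel G (None, \<gamma>) (None, \<alpha>) (None, \<beta>) p = H \<gamma> \<alpha> \<beta> x"
    "christoffel G (None, \<gamma>) (None, \<alpha>) (Some j, \<beta>) p = 0"
    "christoffel G (None, \<gamma>) (Some i, \<alpha>) (None, \<beta>) p = 0"
    "christoffel G (None, \<gamma>) (Some i, \<alpha>) (Some j, \<beta>) p = (if i = j then - \<epsilon>s i * exp (- L x) * T \<gamma> \<alpha> \<beta> x else 0)"
    "christoffel G (Some k, \<gamma>) (None, \<alpha>) (None, \<beta>) p = 0"
    "christoffel G (Some k, \<gamma>) (None, \<alpha>) (Some j, \<beta>) p = (if j = k then T \<gamma> \<alpha> \<beta> x else 0)"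
    "christoffel G (Some k, \<gamma>) (Some i, \<alpha>) (None, \<beta>) p = (if i = k then T \<gamma> \<alpha> \<beta> x else 0)"
    "christoffel G (Some k, \<gamma>) (Some i, \<alpha>) (Some j, \<beta>) p = 0"
proof -
  have U: "x \<in> U"
    using p by (simp add: total_domain_def x_def)
  have u3: "u \<delta> \<alpha> \<beta> x = u \<alpha> \<beta> \<delta> x" "u \<beta> \<alpha> \<delta> x = u \<alpha> \<beta> \<delta> x" for \<delta>
    using u_sym12[OF U] u_sym23 by metis+
  have g_gi: "(\<Sum>\<delta>\<in>UNIV. gi \<gamma> \<delta> x * g x $ \<mu> $ \<delta>) = (if \<gamma> = \<mu> then 1 else 0)" for \<mu>
    using gi_g[OF U, of \<gamma> \<mu>] by (simp add: g_sym[of x \<mu>])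
  have \<epsilon>s': "\<epsilon>s k * (\<epsilon>s k * z) = z" for z
    using \<epsilon>s[of k] by (simp flip: mult.assoc)
  let ?P = "\<lambda>\<mu>. partial_deriv \<mu> L x"
  have "christoffel G (None, \<gamma>) (None, \<alpha>) (None, \<beta>) p =
     (1/2) * (\<Sum>\<delta>\<in>UNIV. gi \<gamma> \<delta> x * u \<alpha> \<beta> \<delta> x + ?P \<alpha> * (gi \<gamma> \<delta> x * g x $ \<beta> $ \<delta>)
        + ?P \<beta> * (gi \<gamma> \<delta> x * g x $ \<alpha> $ \<delta>) - g x $ \<alpha> $ \<beta> * (gi \<gamma> \<delta> x * ?P \<delta>))"
    unfolding christoffel_G[OF p] partial_G[OF p]
    by (intro arg_cong[where f = "\<lambda>s. (1/2) * s"] sum.cong)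
       (simp_all add: u3 exp_minus divide_simps algebra_simps flip: x_def)
  also have "\<dots> = (1/2) * ((\<Sum>\<delta>\<in>UNIV. gi \<gamma> \<delta> x * u \<alpha> \<beta> \<delta> x) + ?P \<alpha> * (\<Sum>\<delta>\<in>UNIV. gi \<gamma> \<delta> x * g x $ \<beta> $ \<delta>)
        + ?P \<beta> * (\<Sum>\<delta>\<in>UNIV. gi \<gamma> \<delta> x * g x $ \<alpha> $ \<delta>) - g x $ \<alpha> $ \<beta> * (\<Sum>\<delta>\<in>UNIV. gi \<gamma> \<delta> x * ?P \<delta>))"
    by (simp only: sum.distrib sum_subtractf sum_distrib_left)
  also have "\<dots> = H \<gamma> \<alpha> \<beta> x"
    unfolding g_gi H_def T_def by (simp add: distrib_left right_diff_distrib)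
  finally show "christoffel G (None, \<gamma>) (None, \<alpha>) (None, \<beta>) p = H \<gamma> \<alpha> \<beta> x" .
  show 
    "christoffel G (None, \<gamma>) (None, \<alpha>) (Some j, \<beta>) p = 0"
    "christoffel G (None, \<gamma>) (Some i, \<alpha>) (None, \<beta>) p = 0"
    "christoffel G (None, \<gamma>) (Some i, \<alpha>) (Some j, \<beta>) p = (if i = j then - \<epsilon>s i * exp (- L x) * T \<gamma> \<alpha> \<beta> x else 0)"
    "christoffel G (Some k, \<gamma>) (None, \<alpha>) (None, \<beta>) p = 0"
    "christoffel G (Some k, \<gamma>) (None, \<alpha>) (Some j, \<beta>) p = (if j = k then T \<gamma> \<alpha> \<beta> x else 0)"
    "christoffel G (Some k, \<gamma>) (Some i, \<alpha>) (None, \<beta>) p = (if i = k then T \<gamma> \<alpha> \<beta> x else 0)"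
    "christoffel G (Some k, \<gamma>) (Some i, \<alpha>) (Some j, \<beta>) p = 0"
    unfolding christoffel_G[OF p] partial_G[OF p] T_def x_def[symmetric]
    by (simp_all add: u3 sum_2) (auto simp: algebra_simps \<epsilon>s')
qed

text \<open>The formulas of \<open>christoffel_cases\<close> hold on an open set and involve only
  the base point, so they may be differentiated there, with derivative zero along the
  fibres.\<close>

lemma partial_christoffel:
  assumes p: "p \<in> total_domain U" and f: "\<And>q. q \<in> total_domain U \<Longrightarrow> christoffel G c a b q = f (base_point q)"
  shows "partial_deriv (m, \<mu>) (christoffel G c a b) p = (case m of None \<Rightarrow> partial_deriv \<mu> f (base_point p) | Some i \<Rightarrow> 0)"
proof -
  have "partial_deriv (m, \<mu>) (christoffel G c a b) p = partial_deriv (m, \<mu>) (\<lambda>q. f (base_point q)) p"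
    by (rule partial_deriv_cong[OF open_total_domain[OF open_U] p]) (simp add: f)
  then show ?thesis
    unfolding partial_deriv_base_point by (simp cong: option.case_cong)
qed

lemma partial_christoffel_cases:
  assumes p: "p \<in> total_domain U"
  defines "x \<equiv> base_point p"
  shows
    "partial_deriv (None, \<mu>) (christoffel G (None, \<gamma>) (None, \<alpha>) (None, \<beta>)) p = partial_deriv \<mu> (H \<gamma> \<alpha> \<beta>) x"
    "partial_deriv (Some m, \<mu>) (christoffel G c a b) p = 0"
    "partial_deriv (None, \<mu>) (christoffel G (None, \<gamma>) (None, \<alpha>) (Some j, \<beta>)) p = 0"
    "partial_deriv (None, \<mu>) (christoffel G (None, \<gamma>) (Some i, \<alpha>) (None, \<beta>)) p = 0"
    "partial_deriv (None, \<mu>) (christoffel G (None, \<gamma>) (Some i, \<alpha>) (Some j, \<beta>)) p =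
       (if i = j then partial_deriv \<mu> (\<lambda>x. - \<epsilon>s i * exp (- L x) * T \<gamma> \<alpha> \<beta> x) x else 0)"
    "partial_deriv (None, \<mu>) (christoffel G (Some k, \<gamma>) (None, \<alpha>) (None, \<beta>)) p = 0"
    "partial_deriv (None, \<mu>) (christoffel G (Some k, \<gamma>) (None, \<alpha>) (Some j, \<beta>)) p =
       (if j = k then partial_deriv \<mu> (T \<gamma> \<alpha> \<beta>) x else 0)"
    "partial_deriv (None, \<mu>) (christoffel G (Some k, \<gamma>) (Some i, \<alpha>) (None, \<beta>)) p =
       (if i = k then partial_deriv \<mu> (T \<gamma> \<alpha> \<beta>) x else 0)"
    "partial_deriv (None, \<mu>) (christoffel G (Some k, \<gamma>) (Some i, \<alpha>) (Some j, \<beta>)) p = 0"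
proof -
  note * = partial_christoffel[OF p christoffel_cases(1)] partial_christoffel[OF p christoffel_cases(2)]
     partial_christoffel[OF p christoffel_cases(3)] partial_christoffel[OF p christoffel_cases(4)]
     partial_christoffel[OF p christoffel_cases(5)] partial_christoffel[OF p christoffel_cases(6)]
     partial_christoffel[OF p christoffel_cases(7)] partial_christoffel[OF p christoffel_cases(8)]
  show "partial_deriv (Some m, \<mu>) (christoffel G c a b) p = 0"
    by (cases c; cases a; cases b; cases "fst c"; cases "fst a"; cases "fst b") (simp_all add: *)
qed (simp_all add: partial_christoffel[OF p christoffel_cases(1)] partial_christoffel[OF p christoffel_cases(2)]
     partial_christoffel[OF p christoffel_cases(3)] partial_christoffel[OF p christoffel_cases(4)]
     partial_christoffel[OF p christoffel_cases(5)] partial_christoffel[OF p christoffel_cases(6)]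
     partial_christoffel[OF p christoffel_cases(7)] partial_christoffel[OF p christoffel_cases(8)] x_def)

end

section \<open>The Ricci tensor of the block metric\<close>

lemma sum_if_if:
  fixes a b :: real and i j :: "'n::finite"
  shows "(\<Sum>k\<in>UNIV. (if j = k then a else 0) * (if i = k then b else 0)) = (if i = j then a * b else 0)"
    "(\<Sum>k\<in>UNIV. (if k = j then a else 0) * (if i = k then b else 0)) = (if i = j then a * b else 0)"
proof -
  have "(\<Sum>k\<in>UNIV. (if j = k then a else 0) * (if i = k then b else 0)) = (\<Sum>k\<in>UNIV. if j = k then if i = j then a * b else 0 else 0)"
    by (rule sum.cong) auto
  then show "(\<Sum>k\<in>UNIV. (if j = k then a else 0) * (if i = k then b else 0)) = (if i = j then a * b else 0)"
    by simp
  then show "(\<Sum>k\<in>UNIV. (if k = j then a else 0) * (if i = k then b else 0)) = (if i = j then a * b else 0)"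
    by (simp add: eq_commute[of j])
qed

context block_metric begin

text \<open>A parity argument: symbols with an odd number of fibre indices vanish. With exactly one
  free fibre index, every product contains such a symbol, and every derivative term either
  differentiates one or is taken along a fibre.\<close>

lemma ricci_mixed:
  assumes p: "p \<in> total_domain U"
  shows "ricci G (None, \<gamma>) (Some i, \<beta>) p = 0" "ricci G (Some i, \<gamma>) (None, \<beta>) p = 0"
  unfolding ricci_def riemann_def sum_option_times
  by (simp_all add: christoffel_cases[OF p] partial_christoffel_cases[OF p])

lemma riemann_fibre:
  assumes p: "p \<in> total_domain U"
  defines "x \<equiv> base_point p"
  shows "riemann G (None, \<alpha>) (Some i, \<gamma>) (None, \<alpha>) (Some j, \<beta>) p = (if i = j then
      partial_deriv \<alpha> (\<lambda>x. - \<epsilon>s i * exp (- L x) * T \<alpha> \<beta> \<gamma> x) x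
      + (\<Sum>\<epsilon>\<in>UNIV. H \<alpha> \<alpha> \<epsilon> x * (- \<epsilon>s i * exp (- L x) * T \<epsilon> \<beta> \<gamma> x))
      - (\<Sum>\<epsilon>\<in>UNIV. (- \<epsilon>s i * exp (- L x) * T \<alpha> \<beta> \<epsilon> x) * T \<epsilon> \<alpha> \<gamma> x) else 0)"
   "riemann G (Some k, \<alpha>) (Some i, \<gamma>) (Some k, \<alpha>) (Some j, \<beta>) p = (if i = j then
      (\<Sum>\<epsilon>\<in>UNIV. T \<alpha> \<alpha> \<epsilon> x * (- \<epsilon>s i * exp (- L x) * T \<epsilon> \<beta> \<gamma> x)) else 0)
      - (if k = i then if i = j then (\<Sum>\<epsilon>\<in>UNIV. T \<alpha> \<beta> \<epsilon> x * (- \<epsilon>s i * exp (- L x) * T \<epsilon> \<alpha> \<gamma> x)) else 0 else 0)"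
  unfolding riemann_def sum_option_times
  by (auto simp: christoffel_cases[OF p] partial_christoffel_cases[OF p] sum_subtractf sum_negf sum_if_if sum_2 x_def)

lemma riemann_base:
  assumes p: "p \<in> total_domain U"
  defines "x \<equiv> base_point p"
  shows "riemann G (None, \<alpha>) (None, \<gamma>) (None, \<alpha>) (None, \<beta>) p =
      partial_deriv \<alpha> (H \<alpha> \<beta> \<gamma>) x - partial_deriv \<beta> (H \<alpha> \<alpha> \<gamma>) x
      + (\<Sum>\<epsilon>\<in>UNIV. H \<alpha> \<alpha> \<epsilon> x * H \<epsilon> \<beta> \<gamma> x - H \<alpha> \<beta> \<epsilon> x * H \<epsilon> \<alpha> \<gamma> x)"
   "riemann G (Some i, \<alpha>) (None, \<gamma>) (Some i, \<alpha>) (None, \<beta>) p = - partial_deriv \<beta> (T \<alpha> \<alpha> \<gamma>) x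
      + (\<Sum>\<epsilon>\<in>UNIV. T \<alpha> \<alpha> \<epsilon> x * H \<epsilon> \<beta> \<gamma> x - T \<alpha> \<beta> \<epsilon> x * T \<epsilon> \<alpha> \<gamma> x)"
  unfolding riemann_def sum_option_times
  by (auto simp: christoffel_cases[OF p] partial_christoffel_cases[OF p] sum_subtractf sum_negf sum_if_if sum_2 x_def)

text \<open>Each of the \<open>CARD('n)\<close> factors contributes a trace of \<open>T\<close>. The
  product of two \<open>T\<close> arises once from the base directions and once from the factor
  \<open>i\<close> itself, hence the coefficient 2.\<close>

lemma ricci_fibre:
  assumes p: "p \<in> total_domain U"
  defines "x \<equiv> base_point p"
  shows "ricci G (Some i, \<gamma>) (Some j, \<beta>) p = (if i = j then
     (\<Sum>\<alpha>\<in>UNIV. partial_deriv \<alpha> (\<lambda>x. - \<epsilon>s i * exp (- L x) * T \<alpha> \<beta> \<gamma> x) x)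
      + (- \<epsilon>s i * exp (- L x)) * (\<Sum>\<alpha>\<in>UNIV. \<Sum>\<epsilon>\<in>UNIV. (H \<alpha> \<alpha> \<epsilon> x + real CARD('n) * T \<alpha> \<alpha> \<epsilon> x) * T \<epsilon> \<beta> \<gamma> x
          - 2 * T \<alpha> \<beta> \<epsilon> x * T \<epsilon> \<alpha> \<gamma> x) else 0)"
  unfolding ricci_def sum_option_times riemann_fibre[OF p] x_def
  by (auto simp: sum.distrib sum_subtractf sum_2 algebra_simps)

text \<open>The terms without \<open>CARD('n)\<close> form the Ricci tensor of the conformal base
  metric; every fibre factor adds the same trace and quadratic terms in \<open>T\<close>.\<close>

lemma ricci_base:
  assumes p: "p \<in> total_domain U"
  defines "x \<equiv> base_point p"
  shows "ricci G (None, \<gamma>) (None, \<beta>) p =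
     (\<Sum>\<alpha>\<in>UNIV. partial_deriv \<alpha> (H \<alpha> \<beta> \<gamma>) x - partial_deriv \<beta> (H \<alpha> \<alpha> \<gamma>) x - real CARD('n) * partial_deriv \<beta> (T \<alpha> \<alpha> \<gamma>) x)
      + (\<Sum>\<alpha>\<in>UNIV. \<Sum>\<epsilon>\<in>UNIV. (H \<alpha> \<alpha> \<epsilon> x + real CARD('n) * T \<alpha> \<alpha> \<epsilon> x) * H \<epsilon> \<beta> \<gamma> x
          - H \<alpha> \<beta> \<epsilon> x * H \<epsilon> \<alpha> \<gamma> x - real CARD('n) * (T \<alpha> \<beta> \<epsilon> x * T \<epsilon> \<alpha> \<gamma> x))"
  unfolding ricci_def sum_option_times riemann_base[OF p] x_def
  by (simp add: sum.distrib sum_subtractf sum_2 algebra_simps)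

end

section \<open>Curvature identities for Hessian metrics of constant determinant\<close>

text \<open>Here \<open>a, b, c\<close> are \<open>g11, g12, g22\<close> and
  \<open>p, q, r, s\<close> are \<open>u111, u112, u122, u222\<close>; the premises are the two
  derivatives of the constant determinant. The factors on the left are the symbols \<open>T\<close>
  multiplied by \<open>2 * D\<close>. The four equations are the index pairs (1,1), (1,2), (2,1),
  (2,2) in the literal form in which \<open>TT_eq\<close> meets them.\<close>

lemma hessian_det_identities:
  fixes a b c p q r s :: real
  assumes "p * c + a * r - 2 * b * q = 0" "q * c + a * s - 2 * b * r = 0"
  shows "(c * p - b * q) * (c * p - b * q) + (c * q - b * r) * (a * q - b * p)
     + ((a * q - b * p) * (c * q - b * r) + (a * r - b * q) * (a * r - b * q)) = (a * c - b\<^sup>2) * (2 * q * q - p * r - r * p)"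
   "(c * p - b * q) * (c * q - b * r) + (c * q - b * r) * (a * r - b * q)
     + ((a * q - b * p) * (c * r - b * s) + (a * r - b * q) * (a * s - b * r)) = (a * c - b\<^sup>2) * (2 * q * r - p * s - r * q)"
   "(c * q - b * r) * (c * p - b * q) + (c * r - b * s) * (a * q - b * p)
     + ((a * r - b * q) * (c * q - b * r) + (a * s - b * r) * (a * r - b * q)) = (a * c - b\<^sup>2) * (2 * r * q - q * r - s * p)"
   "(c * q - b * r) * (c * q - b * r) + (c * r - b * s) * (a * r - b * q)
     + ((a * r - b * q) * (c * r - b * s) + (a * s - b * r) * (a * s - b * r)) = (a * c - b\<^sup>2) * (2 * r * r - q * s - s * q)"
  using assms by algebra+

text \<open>\<open>Tcab\<close> and \<open>Hcab\<close> are the Christoffel symbols, upper index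
  first, of \<open>g\<close> and of \<open>exp L\<close> times \<open>g\<close>, and
  \<open>V\<close> is the gradient of \<open>L\<close>. The premises on \<open>T\<close> say that it
  is trace-free and totally symmetric after lowering the index. Then all terms that the conformal
  change adds cancel.\<close>

lemma conformal_connection_identities:
  fixes a b c L1 L2 :: real
  assumes "T212 = - T111" "T222 = - T112"
   "a * T112 + b * T212 = b * T111 + c * T211" "a * T122 + b * T222 = b * T112 + c * T212"
   "a * V1 + b * V2 = L1" "b * V1 + c * V2 = L2"
   "H111 = T111 + (1/2) * (L1 + L1 - a * V1)" "H211 = T211 + (1/2) * (- (a * V2))"
   "H112 = T112 + (1/2) * (L2 - b * V1)" "H212 = T212 + (1/2) * (L1 - b * V2)"
   "H122 = T122 + (1/2) * (- (c * V1))" "H222 = T222 + (1/2) * (L2 + L2 - c * V2)"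
  shows
  "L1 * H111 + L2 * H211 - (H111 * H111 + H112 * H211 + (H211 * H112 + H212 * H212))
   = L1 * T111 + L2 * T211 - (T111 * T111 + T112 * T211 + (T211 * T112 + T212 * T212))"
  "L1 * H112 + L2 * H212 - (H111 * H112 + H112 * H212 + (H211 * H122 + H212 * H222))
   = L1 * T112 + L2 * T212 - (T111 * T112 + T112 * T212 + (T211 * T122 + T212 * T222))"
  "L1 * H122 + L2 * H222 - (H112 * H112 + H122 * H212 + (H212 * H122 + H222 * H222))
   = L1 * T122 + L2 * T222 - (T112 * T112 + T122 * T212 + (T212 * T122 + T222 * T222))"
  \<comment> \<open>Eliminating \<open>H\<close>, then \<open>L1, L2\<close> in favour of
    \<open>V1, V2\<close>, then the dependent components of \<open>T\<close>, leaves polynomial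
    identities modulo the two lowered symmetry relations.\<close>
  using assms(3,4) unfolding assms(7-) unfolding assms(5,6)[symmetric] assms(1,2) by algebra+

context hessian_metric begin

abbreviation d1L :: "2 \<Rightarrow> real ^ 2 \<Rightarrow> real" where "d1L \<alpha> \<equiv> partial_deriv \<alpha> L"
abbreviation d2L :: "2 \<Rightarrow> 2 \<Rightarrow> real ^ 2 \<Rightarrow> real" where "d2L \<mu> \<alpha> \<equiv> partial_deriv \<mu> (partial_deriv \<alpha> L)"

definition v :: "2 \<Rightarrow> 2 \<Rightarrow> 2 \<Rightarrow> 2 \<Rightarrow> real ^ 2 \<Rightarrow> real" where
  "v \<mu> \<alpha> \<beta> \<gamma> = partial_deriv \<mu> (u \<alpha> \<beta> \<gamma>)"

definition TT :: "2 \<Rightarrow> 2 \<Rightarrow> real ^ 2 \<Rightarrow> real" where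
  "TT \<beta> \<gamma> x = (\<Sum>\<alpha>\<in>UNIV. \<Sum>\<epsilon>\<in>UNIV. T \<alpha> \<beta> \<epsilon> x * T \<epsilon> \<alpha> \<gamma> x)"

lemma smooth_u: "smooth_on U (u \<alpha> \<beta> \<gamma>)"
  unfolding u_def by (rule smooth_on_partial_deriv[OF smooth_g])

context
  fixes x assumes x: "x \<in> U"
begin

text \<open>Sorting the indices leaves four independent first derivatives, so that the polynomial
  identities above can match.\<close>

lemma u_canon: "u 2 1 1 x = u 1 1 2 x" "u 2 1 2 x = u 1 2 2 x" "u 1 2 1 x = u 1 1 2 x" "u 2 2 1 x = u 1 2 2 x"
  using u_sym12[OF x] u_sym23 by metis+

lemma v_sym12: "v \<mu> \<alpha> \<beta> \<gamma> x = v \<alpha> \<mu> \<beta> \<gamma> x"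
  unfolding v_def u_def by (rule smooth_on_partial_deriv_commute[OF open_U smooth_g x])

lemma v_sym23: "v \<mu> \<alpha> \<beta> \<gamma> x = v \<mu> \<beta> \<alpha> \<gamma> x"
  unfolding v_def by (rule partial_deriv_cong[OF open_U x]) (rule u_sym12)

lemma v_sym34: "v \<mu> \<alpha> \<beta> \<gamma> x = v \<mu> \<alpha> \<gamma> \<beta> x"
  unfolding v_def using u_sym23 by metis

text \<open>\<open>v\<close> is totally symmetric: the first two indices commute as partial
  derivatives, and the other exchanges are derivatives of the symmetries of
  \<open>u\<close>.\<close>

lemma v_canon: "v 2 1 \<alpha> \<beta> x = v 1 2 \<alpha> \<beta> x" "v \<alpha> 2 1 \<beta> x = v \<alpha> 1 2 \<beta> x" "v \<alpha> \<beta> 2 1 x = v \<alpha> \<beta> 1 2 x"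
  by (rule v_sym12 v_sym23 v_sym34)+

lemma has_partial_g:
  "((\<lambda>t. g (x + t *\<^sub>R axis \<mu> 1) $ \<alpha> $ \<beta>) has_real_derivative u \<mu> \<alpha> \<beta> x) (at 0)"
  unfolding u_def by (rule smooth_on_has_partial_deriv[OF smooth_g x])

lemma has_partial_u:
  "((\<lambda>t. u \<alpha> \<beta> \<gamma> (x + t *\<^sub>R axis \<mu> 1)) has_real_derivative v \<mu> \<alpha> \<beta> \<gamma> x) (at 0)"
  unfolding v_def by (rule smooth_on_has_partial_deriv[OF smooth_u x])

lemma det_deriv: "u \<mu> 1 1 x * g x $ 2 $ 2 + g x $ 1 $ 1 * u \<mu> 2 2 x - 2 * g x $ 1 $ 2 * u \<mu> 1 2 x = 0"
proof -
  have "u \<mu> 1 1 x * g x $ 2 $ 2 + g x $ 1 $ 1 * u \<mu> 2 2 x - 2 * g x $ 1 $ 2 * u \<mu> 1 2 x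
      = partial_deriv \<mu> (\<lambda>x. g x $ 1 $ 1 * g x $ 2 $ 2 - (g x $ 1 $ 2)\<^sup>2) x"
    by (rule partial_deriv_eqI[symmetric])
       (auto intro!: derivative_eq_intros has_partial_g)
  also have "\<dots> = partial_deriv \<mu> (\<lambda>x. D) x"
    by (rule partial_deriv_cong[OF open_U x]) (rule det_g)
  finally show ?thesis
    by simp
qed
end

text \<open>Differentiating \<open>det_deriv\<close> once more trades a trace of second derivatives
  of \<open>g\<close> for products of first derivatives.\<close>

lemma det_deriv2:
  assumes x: "x \<in> U"
  shows "v \<mu> \<nu> 1 1 x * g x $ 2 $ 2 + g x $ 1 $ 1 * v \<mu> \<nu> 2 2 x - 2 * g x $ 1 $ 2 * v \<mu> \<nu> 1 2 x
     = 2 * u \<mu> 1 2 x * u \<nu> 1 2 x - u \<mu> 1 1 x * u \<nu> 2 2 x - u \<mu> 2 2 x * u \<nu> 1 1 x"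
proof -
  have "v \<mu> \<nu> 1 1 x * g x $ 2 $ 2 + g x $ 1 $ 1 * v \<mu> \<nu> 2 2 x - 2 * g x $ 1 $ 2 * v \<mu> \<nu> 1 2 x
     - (2 * u \<mu> 1 2 x * u \<nu> 1 2 x - u \<mu> 1 1 x * u \<nu> 2 2 x - u \<mu> 2 2 x * u \<nu> 1 1 x)
      = partial_deriv \<mu> (\<lambda>x. u \<nu> 1 1 x * g x $ 2 $ 2 + g x $ 1 $ 1 * u \<nu> 2 2 x - 2 * g x $ 1 $ 2 * u \<nu> 1 2 x) x"
    by (rule partial_deriv_eqI[symmetric])
       (auto intro!: derivative_eq_intros has_partial_g[OF x] has_partial_u[OF x] simp: algebra_simps)
  also have "\<dots> = partial_deriv \<mu> (\<lambda>x. 0) x"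
    by (rule partial_deriv_cong[OF open_U x]) (rule det_deriv)
  finally show ?thesis
    by simp
qed

lemma T_explicit:
  "T 1 \<alpha> \<beta> x = (g x $ 2 $ 2 * u \<alpha> \<beta> 1 x - g x $ 1 $ 2 * u \<alpha> \<beta> 2 x) / (2 * D)"
  "T 2 \<alpha> \<beta> x = (g x $ 1 $ 1 * u \<alpha> \<beta> 2 x - g x $ 1 $ 2 * u \<alpha> \<beta> 1 x) / (2 * D)"
  using D_nz by (simp_all add: T_def gi_def sum_2 field_simps)

lemma T_sym: "x \<in> U \<Longrightarrow> T \<gamma> \<alpha> \<beta> x = T \<gamma> \<beta> \<alpha> x"
  unfolding T_def using u_sym12 by simp

lemma T_mult:
  "2 * D * T 1 \<alpha> \<beta> x = g x $ 2 $ 2 * u \<alpha> \<beta> 1 x - g x $ 1 $ 2 * u \<alpha> \<beta> 2 x"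
  "2 * D * T 2 \<alpha> \<beta> x = g x $ 1 $ 1 * u \<alpha> \<beta> 2 x - g x $ 1 $ 2 * u \<alpha> \<beta> 1 x"
  using D_nz by (simp_all add: T_explicit)

text \<open>The trace of the Christoffel symbols is half the logarithmic derivative of the
  determinant, which is constant.\<close>

lemma T_trace:
  assumes x: "x \<in> U"
  shows "T 1 1 \<beta> x + T 2 2 \<beta> x = 0"
proof -
  have "2 * D * (T 1 1 \<beta> x + T 2 2 \<beta> x) = 0"
    using det_deriv[OF x, of \<beta>] exhaust_2[of \<beta>] unfolding distrib_left T_mult
    by (auto simp: u_canon[OF x] algebra_simps)
  then show ?thesis using D_nz by simp
qed

text \<open>The derivative in direction \<open>\<mu>\<close> of
  \<open>T \<gamma> \<alpha> \<beta>\<close>, read off from \<open>T_explicit\<close> by the product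
  rule and confirmed in \<open>has_partial_T\<close>.\<close>

definition dT :: "2 \<Rightarrow> 2 \<Rightarrow> 2 \<Rightarrow> 2 \<Rightarrow> real ^ 2 \<Rightarrow> real" where
  "dT \<mu> \<gamma> \<alpha> \<beta> x = (if \<gamma> = 1
     then u \<mu> 2 2 x * u \<alpha> \<beta> 1 x + g x $ 2 $ 2 * v \<mu> \<alpha> \<beta> 1 x - u \<mu> 1 2 x * u \<alpha> \<beta> 2 x - g x $ 1 $ 2 * v \<mu> \<alpha> \<beta> 2 x
     else u \<mu> 1 1 x * u \<alpha> \<beta> 2 x + g x $ 1 $ 1 * v \<mu> \<alpha> \<beta> 2 x - u \<mu> 1 2 x * u \<alpha> \<beta> 1 x - g x $ 1 $ 2 * v \<mu> \<alpha> \<beta> 1 x)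
     / (2 * D)"

lemma has_partial_T:
  assumes x: "x \<in> U"
  shows "((\<lambda>t. T \<gamma> \<alpha> \<beta> (x + t *\<^sub>R axis \<mu> 1)) has_real_derivative dT \<mu> \<gamma> \<alpha> \<beta> x) (at 0)"
proof -
  have "((\<lambda>t. T 1 \<alpha> \<beta> (x + t *\<^sub>R axis \<mu> 1)) has_real_derivative dT \<mu> 1 \<alpha> \<beta> x) (at 0)"
    unfolding T_explicit dT_def if_P[OF refl]
    by (rule DERIV_cdivide) (auto intro!: derivative_eq_intros has_partial_g[OF x] has_partial_u[OF x])
  moreover have "((\<lambda>t. T 2 \<alpha> \<beta> (x + t *\<^sub>R axis \<mu> 1)) has_real_derivative dT \<mu> 2 \<alpha> \<beta> x) (at 0)"
    unfolding T_explicit dT_def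
    by (rule DERIV_cdivide) (auto intro!: derivative_eq_intros has_partial_g[OF x] has_partial_u[OF x])
  ultimately show ?thesis
    using exhaust_2[of \<gamma>] by auto
qed

lemma TT_eq:
  assumes x: "x \<in> U"
  shows "TT \<beta> \<gamma> x = (2 * u \<beta> 1 2 x * u \<gamma> 1 2 x - u \<beta> 1 1 x * u \<gamma> 2 2 x - u \<beta> 2 2 x * u \<gamma> 1 1 x) / (4 * D)"
proof -
  have D: "D = g x $ 1 $ 1 * g x $ 2 $ 2 - (g x $ 1 $ 2)\<^sup>2"
    using det_g[OF x] by simp
  note id = hessian_det_identities[OF det_deriv[OF x, of 1] det_deriv[OF x, of 2, unfolded u_canon[OF x]], folded D]
  \<comment> \<open>The additional factor \<open>D\<close> gives each \<open>T\<close> its own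
    \<open>2 * D\<close>, so that \<open>T_mult\<close> makes the expression polynomial.\<close>
  have "D * (4 * D * TT \<beta> \<gamma> x) = (\<Sum>\<alpha>\<in>UNIV. \<Sum>\<epsilon>\<in>UNIV. (2 * D * T \<alpha> \<beta> \<epsilon> x) * (2 * D * T \<epsilon> \<alpha> \<gamma> x))"
    by (simp add: TT_def sum_2 algebra_simps)
  also have "\<dots> = D * (2 * u \<beta> 1 2 x * u \<gamma> 1 2 x - u \<beta> 1 1 x * u \<gamma> 2 2 x - u \<beta> 2 2 x * u \<gamma> 1 1 x)"
  proof -
    consider "\<beta> = 1" "\<gamma> = 1" | "\<beta> = 1" "\<gamma> = 2" | "\<beta> = 2" "\<gamma> = 1" | "\<beta> = 2" "\<gamma> = 2"
      using exhaust_2[of \<beta>] exhaust_2[of \<gamma>] by blast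
    then show ?thesis
    proof cases
      case 1
      show ?thesis unfolding 1 sum_2 T_mult u_canon[OF x] by (rule id(1))
    next
      case 2
      show ?thesis unfolding 2 sum_2 T_mult u_canon[OF x] by (rule id(2))
    next
      case 3
      show ?thesis unfolding 3 sum_2 T_mult u_canon[OF x] by (rule id(3))
    next
      case 4
      show ?thesis unfolding 4 sum_2 T_mult u_canon[OF x] by (rule id(4))
    qed
  qed
  finally show ?thesis
    using D_nz by (simp add: nonzero_eq_divide_eq mult.commute)
qed

text \<open>By total symmetry the products of first derivatives cancel in the divergence. What
  remains is the trace of second derivatives of \<open>g\<close>, which \<open>det_deriv2\<close>
  identifies with the numerator in \<open>TT_eq\<close>.\<close>

lemma div_T:
  assumes x: "x \<in> U"
  shows "(\<Sum>\<alpha>\<in>UNIV. dT \<alpha> \<alpha> \<beta> \<gamma> x) = 2 * TT \<beta> \<gamma> x"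
  unfolding TT_eq[OF x] det_deriv2[OF x, symmetric]
  using exhaust_2[of \<beta>] exhaust_2[of \<gamma>] D_nz
  by (auto simp: dT_def sum_2 u_canon[OF x] v_canon[OF x] field_simps)

section \<open>The conformal change of the base metric\<close>

definition V :: "2 \<Rightarrow> real ^ 2 \<Rightarrow> real" where
  "V \<gamma> x = (\<Sum>\<delta>\<in>UNIV. gi \<gamma> \<delta> x * d1L \<delta> x)"

text \<open>The derivative in direction \<open>\<mu>\<close> of the gradient component
  \<open>V \<gamma>\<close>, by the product rule.\<close>

definition dV :: "2 \<Rightarrow> 2 \<Rightarrow> real ^ 2 \<Rightarrow> real" where
  "dV \<mu> \<gamma> x = (if \<gamma> = 1
     then u \<mu> 2 2 x * d1L 1 x + g x $ 2 $ 2 * d2L \<mu> 1 x - u \<mu> 1 2 x * d1L 2 x - g x $ 1 $ 2 * d2L \<mu> 2 x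
     else u \<mu> 1 1 x * d1L 2 x + g x $ 1 $ 1 * d2L \<mu> 2 x - u \<mu> 1 2 x * d1L 1 x - g x $ 1 $ 2 * d2L \<mu> 1 x) / D"

definition dH :: "2 \<Rightarrow> 2 \<Rightarrow> 2 \<Rightarrow> 2 \<Rightarrow> real ^ 2 \<Rightarrow> real" where
  "dH \<mu> \<gamma> \<alpha> \<beta> x = dT \<mu> \<gamma> \<alpha> \<beta> x + (1/2) * ((if \<gamma> = \<beta> then d2L \<mu> \<alpha> x else 0)
     + (if \<gamma> = \<alpha> then d2L \<mu> \<beta> x else 0) - (u \<mu> \<alpha> \<beta> x * V \<gamma> x + g x $ \<alpha> $ \<beta> * dV \<mu> \<gamma> x))"

lemma H_V:
  "H \<gamma> \<alpha> \<beta> x = T \<gamma> \<alpha> \<beta> x + (1/2) * ((if \<gamma> = \<beta> then d1L \<alpha> x else 0)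
     + (if \<gamma> = \<alpha> then d1L \<beta> x else 0) - g x $ \<alpha> $ \<beta> * V \<gamma> x)"
  by (simp add: H_def V_def)

lemma V_explicit:
  "V 1 x = (g x $ 2 $ 2 * d1L 1 x - g x $ 1 $ 2 * d1L 2 x) / D"
  "V 2 x = (g x $ 1 $ 1 * d1L 2 x - g x $ 1 $ 2 * d1L 1 x) / D"
  by (simp_all add: V_def gi_def sum_2 diff_divide_distrib)

context
  fixes x assumes x: "x \<in> U"
begin

lemma has_partial_dL:
  "((\<lambda>t. d1L \<alpha> (x + t *\<^sub>R axis \<mu> 1)) has_real_derivative d2L \<mu> \<alpha> x) (at 0)"
  by (rule smooth_on_has_partial_deriv[OF smooth_on_partial_deriv[OF smooth_L] x])

lemma d2L_sym: "d2L \<mu> \<alpha> x = d2L \<alpha> \<mu> x"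
  by (rule smooth_on_partial_deriv_commute[OF open_U smooth_L x])

lemma has_partial_V:
  "((\<lambda>t. V \<gamma> (x + t *\<^sub>R axis \<mu> 1)) has_real_derivative dV \<mu> \<gamma> x) (at 0)"
  using exhaust_2[of \<gamma>] D_nz
  by (auto simp: V_explicit dV_def intro!: derivative_eq_intros has_partial_g[OF x] has_partial_dL)

lemma has_partial_H:
  "((\<lambda>t. H \<gamma> \<alpha> \<beta> (x + t *\<^sub>R axis \<mu> 1)) has_real_derivative dH \<mu> \<gamma> \<alpha> \<beta> x) (at 0)"
  unfolding H_V dH_def
  by (cases "\<gamma> = \<alpha>"; cases "\<gamma> = \<beta>")
     (auto intro!: derivative_eq_intros has_partial_T[OF x] has_partial_g[OF x] has_partial_dL has_partial_V
        simp: algebra_simps add_divide_distrib)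

text \<open>The divergence of the gradient, that is the Laplacian of \<open>L\<close>. It has no
  first-order terms because total symmetry of \<open>u\<close> makes the inverse metric
  divergence-free.\<close>

lemma div_V: "dV 1 1 x + dV 2 2 x = (\<Sum>\<alpha>\<in>UNIV. \<Sum>\<beta>\<in>UNIV. gi \<alpha> \<beta> x * d2L \<alpha> \<beta> x)"
  using D_nz by (simp add: dV_def sum_2 gi_def u_canon[OF x] d2L_sym[of 2 1] field_simps)

lemma u_V: "u 1 \<beta> \<gamma> x * V 1 x + u 2 \<beta> \<gamma> x * V 2 x = 2 * (T 1 \<beta> \<gamma> x * d1L 1 x + T 2 \<beta> \<gamma> x * d1L 2 x)"
  using D_nz exhaust_2[of \<beta>] exhaust_2[of \<gamma>]
  by (auto simp: V_explicit T_explicit u_canon[OF x] field_simps)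

text \<open>The Kronecker terms of \<open>H\<close> yield the Hessian of \<open>L\<close>. The term
  with a derivative of \<open>g\<close> is rewritten by \<open>u_V\<close>, and the divergence of
  \<open>V\<close> gives the Laplacian.\<close>

lemma div_H:
  "(\<Sum>\<alpha>\<in>UNIV. dH \<alpha> \<alpha> \<beta> \<gamma> x) = 2 * TT \<beta> \<gamma> x + d2L \<beta> \<gamma> x
     - (T 1 \<beta> \<gamma> x * d1L 1 x + T 2 \<beta> \<gamma> x * d1L 2 x)
     - (1/2) * g x $ \<beta> $ \<gamma> * (\<Sum>\<alpha>\<in>UNIV. \<Sum>\<beta>\<in>UNIV. gi \<alpha> \<beta> x * d2L \<alpha> \<beta> x)"
  using div_T[OF x, of \<beta> \<gamma>] u_V[of \<beta> \<gamma>] exhaust_2[of \<beta>] exhaust_2[of \<gamma>]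
  unfolding div_V[symmetric]
  by (auto simp: sum_2 dH_def d2L_sym[of 2 1] algebra_simps)

text \<open>Lowering the upper index of \<open>T\<close> gives half of \<open>u\<close>; both sides
  equal half of \<open>u 1 1 2\<close> and half of \<open>u 1 2 2\<close> respectively.\<close>

lemma T_lower:
  "g x $ 1 $ 1 * T 1 1 2 x + g x $ 1 $ 2 * T 2 1 2 x = g x $ 1 $ 2 * T 1 1 1 x + g x $ 2 $ 2 * T 2 1 1 x"
  "g x $ 1 $ 1 * T 1 2 2 x + g x $ 1 $ 2 * T 2 2 2 x = g x $ 1 $ 2 * T 1 1 2 x + g x $ 2 $ 2 * T 2 1 2 x"
  using D_nz by (auto simp: T_explicit u_canon[OF x] field_simps)

lemma g_V: "g x $ \<alpha> $ 1 * V 1 x + g x $ \<alpha> $ 2 * V 2 x = d1L \<alpha> x"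
proof -
  have "D * V 1 x = g x $ 2 $ 2 * d1L 1 x - g x $ 1 $ 2 * d1L 2 x"
    "D * V 2 x = g x $ 1 $ 1 * d1L 2 x - g x $ 1 $ 2 * d1L 1 x"
    using D_nz by (simp_all add: V_explicit)
  then have "D * (g x $ 1 $ 1 * V 1 x + g x $ 1 $ 2 * V 2 x) = D * d1L 1 x"
     "D * (g x $ 1 $ 2 * V 1 x + g x $ 2 $ 2 * V 2 x) = D * d1L 2 x"
    using det_g[OF x] by algebra+
  then show ?thesis
    using D_nz exhaust_2[of \<alpha>] by (auto simp: g21)
qed

lemma H_sym: "H \<gamma> \<alpha> \<beta> x = H \<gamma> \<beta> \<alpha> x"
  by (simp add: H_def T_sym[OF x, of _ \<alpha> \<beta>] g_sym[of x \<alpha> \<beta>])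

text \<open>In dimension two the metric \<open>exp L\<close> times \<open>g\<close> has determinant
  \<open>exp (2 * L) * D\<close>, whose half logarithmic derivative is the derivative of
  \<open>L\<close>.\<close>

lemma trace_H: "H 1 1 \<gamma> x + H 2 2 \<gamma> x = d1L \<gamma> x"
  using T_trace[OF x, of \<gamma>] exhaust_2[of \<gamma>] g_V[of \<gamma>] g21[of x]
  by (auto simp: H_V algebra_simps)

text \<open>The terms linear and quadratic in the derivatives of \<open>L\<close> cancel.\<close>

lemma H_contraction:
  "d1L 1 x * H 1 \<beta> \<gamma> x + d1L 2 x * H 2 \<beta> \<gamma> x - (\<Sum>\<alpha>\<in>UNIV. \<Sum>\<epsilon>\<in>UNIV. H \<alpha> \<beta> \<epsilon> x * H \<epsilon> \<alpha> \<gamma> x)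
    = d1L 1 x * T 1 \<beta> \<gamma> x + d1L 2 x * T 2 \<beta> \<gamma> x - TT \<beta> \<gamma> x"
proof -
  have t: "T 2 1 2 x = - T 1 1 1 x" "T 2 2 2 x = - T 1 1 2 x"
    using T_trace[OF x, of 1] T_trace[OF x, of 2] T_sym[OF x, of 2 1 2] T_sym[OF x, of 1 1 2] by auto
  have h: "H 1 1 1 x = T 1 1 1 x + (1/2) * (d1L 1 x + d1L 1 x - g x $ 1 $ 1 * V 1 x)"
    "H 2 1 1 x = T 2 1 1 x + (1/2) * (- (g x $ 1 $ 1 * V 2 x))"
    "H 1 1 2 x = T 1 1 2 x + (1/2) * (d1L 2 x - g x $ 1 $ 2 * V 1 x)"
    "H 2 1 2 x = T 2 1 2 x + (1/2) * (d1L 1 x - g x $ 1 $ 2 * V 2 x)"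
    "H 1 2 2 x = T 1 2 2 x + (1/2) * (- (g x $ 2 $ 2 * V 1 x))"
    "H 2 2 2 x = T 2 2 2 x + (1/2) * (d1L 2 x + d1L 2 x - g x $ 2 $ 2 * V 2 x)"
    by (simp_all add: H_V)
  note c = conformal_connection_identities[OF t T_lower g_V[of 1] g_V[of 2, unfolded g21] h]
  have sym: "H \<gamma> 2 1 x = H \<gamma> 1 2 x" "T \<gamma> 2 1 x = T \<gamma> 1 2 x" for \<gamma>
    by (rule H_sym, rule T_sym[OF x])
  consider "\<beta> = 1" "\<gamma> = 1" | "\<beta> = 1" "\<gamma> = 2" | "\<beta> = 2" "\<gamma> = 1" | "\<beta> = 2" "\<gamma> = 2"
    using exhaust_2[of \<beta>] exhaust_2[of \<gamma>] by blast
  then show ?thesis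
  proof cases
    case 1
    then show ?thesis using c(1) unfolding TT_def sum_2 by (simp only: sym)
  next
    case 2
    then show ?thesis using c(2) unfolding TT_def sum_2 by (simp only: sym)
  next
    case 3
    \<comment> \<open>The contraction is symmetric in its free indices, so (2,1) follows from (1,2)
      by commuting factors.\<close>
    have "a * d + b' * f + (e' * a + f' * e') = d * a + a * e' + (f * b' + e' * f')" for a d b' f e' f' :: real
      by (simp add: mult.commute)
    with 3 show ?thesis using c(2) unfolding TT_def sum_2 by (simp only: sym)
  next
    case 4
    then show ?thesis using c(3) unfolding TT_def sum_2 by (simp only: sym)
  qed
qed

end

text \<open>For a trace-free, totally symmetric tensor of rank three in dimension two, the
  contraction with itself is a multiple of the metric. In coordinates this follows from the two
  relations \<open>det_deriv\<close>.\<close>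

lemma TT_proportional:
  assumes x: "x \<in> U"
  shows "g x $ 1 $ 1 * TT \<beta> \<gamma> x = TT 1 1 x * g x $ \<beta> $ \<gamma>"
proof -
  let ?N = "\<lambda>\<beta> \<gamma>. 2 * u \<beta> 1 2 x * u \<gamma> 1 2 x - u \<beta> 1 1 x * u \<gamma> 2 2 x - u \<beta> 2 2 x * u \<gamma> 1 1 x"
  have "g x $ 1 $ 1 * ?N 1 2 = ?N 1 1 * g x $ 1 $ 2" "g x $ 1 $ 1 * ?N 2 2 = ?N 1 1 * g x $ 2 $ 2"
    using det_deriv[OF x, of 1] det_deriv[OF x, of 2] unfolding u_canon[OF x] by algebra+
  then have "g x $ 1 $ 1 * ?N \<beta> \<gamma> = ?N 1 1 * g x $ \<beta> $ \<gamma>"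
  proof -
    assume *: "g x $ 1 $ 1 * ?N 1 2 = ?N 1 1 * g x $ 1 $ 2" "g x $ 1 $ 1 * ?N 2 2 = ?N 1 1 * g x $ 2 $ 2"
    have "?N 2 1 = ?N 1 2"
      by (simp add: mult.commute)
    with *(1) have "g x $ 1 $ 1 * ?N 2 1 = ?N 1 1 * g x $ 2 $ 1"
      by (simp only: g21)
    moreover have "g x $ 1 $ 1 * ?N 1 1 = ?N 1 1 * g x $ 1 $ 1"
      by (rule mult.commute)
    ultimately show ?thesis
      using * exhaust_2[of \<beta>] exhaust_2[of \<gamma>] by (elim disjE) (simp_all only:)
  qed
  then show ?thesis
    unfolding TT_eq[OF x] by (simp only: times_divide_eq_left times_divide_eq_right)
qed

lemma partial_trace_H:
  assumes x: "x \<in> U"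
  shows "(\<Sum>\<alpha>\<in>UNIV. partial_deriv \<beta> (H \<alpha> \<alpha> \<gamma>) x) = d2L \<beta> \<gamma> x"
proof -
  have "(\<Sum>\<alpha>\<in>UNIV. partial_deriv \<beta> (H \<alpha> \<alpha> \<gamma>) x) = partial_deriv \<beta> (\<lambda>x. H 1 1 \<gamma> x + H 2 2 \<gamma> x) x"
    unfolding sum_2 partial_deriv_eqI[OF has_partial_H[OF x]]
    by (rule partial_deriv_eqI[symmetric]) (intro DERIV_add has_partial_H[OF x])
  also have "\<dots> = d2L \<beta> \<gamma> x"
    by (rule partial_deriv_cong[OF open_U x]) (rule trace_H)
  finally show ?thesis .
qed

lemma partial_trace_T:
  assumes x: "x \<in> U"
  shows "(\<Sum>\<alpha>\<in>UNIV. partial_deriv \<beta> (T \<alpha> \<alpha> \<gamma>) x) = 0"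
proof -
  have "(\<Sum>\<alpha>\<in>UNIV. partial_deriv \<beta> (T \<alpha> \<alpha> \<gamma>) x) = partial_deriv \<beta> (\<lambda>x. T 1 1 \<gamma> x + T 2 2 \<gamma> x) x"
    unfolding sum_2 partial_deriv_eqI[OF has_partial_T[OF x]]
    by (rule partial_deriv_eqI[symmetric]) (intro DERIV_add has_partial_T[OF x])
  also have "\<dots> = partial_deriv \<beta> (\<lambda>x. 0) x"
    by (rule partial_deriv_cong[OF open_U x]) (rule T_trace)
  finally show ?thesis by simp
qed

end

section \<open>Vanishing of the Ricci tensor\<close>

context block_metric begin

text \<open>Differentiating \<open>exp (- L)\<close> produces a term that the trace of
  \<open>H\<close> cancels. What is left is a multiple of the divergence of \<open>T\<close> minus
  \<open>2 * TT\<close>, which is zero by \<open>div_T\<close>.\<close>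

lemma ricci_fibre_eq_0:
  assumes p: "p \<in> total_domain U"
  shows "ricci G (Some i, \<gamma>) (Some j, \<beta>) p = 0"
proof -
  define x where "x = base_point p"
  have x: "x \<in> U"
    using p by (simp add: total_domain_def x_def)
  let ?K = "- \<epsilon>s i * exp (- L x)"
  have "partial_deriv \<alpha> (\<lambda>x. - \<epsilon>s i * exp (- L x) * T \<alpha> \<beta> \<gamma> x) x
      = ?K * (dT \<alpha> \<alpha> \<beta> \<gamma> x - d1L \<alpha> x * T \<alpha> \<beta> \<gamma> x)" for \<alpha>
    by (rule partial_deriv_eqI)
       (auto intro!: derivative_eq_intros has_partial_T[OF x] smooth_on_has_partial_deriv[OF smooth_L x]
         simp: algebra_simps)
  then have 1: "(\<Sum>\<alpha>\<in>UNIV. partial_deriv \<alpha> (\<lambda>x. - \<epsilon>s i * exp (- L x) * T \<alpha> \<beta> \<gamma> x) x)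
      = ?K * (2 * TT \<beta> \<gamma> x - (d1L 1 x * T 1 \<beta> \<gamma> x + d1L 2 x * T 2 \<beta> \<gamma> x))"
    unfolding div_T[OF x, symmetric] by (simp add: sum_2 algebra_simps)
  have "(\<Sum>\<alpha>\<in>UNIV. \<Sum>\<epsilon>\<in>UNIV. (H \<alpha> \<alpha> \<epsilon> x + real CARD('n) * T \<alpha> \<alpha> \<epsilon> x) * T \<epsilon> \<beta> \<gamma> x
          - 2 * T \<alpha> \<beta> \<epsilon> x * T \<epsilon> \<alpha> \<gamma> x)
     = (H 1 1 1 x + H 2 2 1 x) * T 1 \<beta> \<gamma> x + (H 1 1 2 x + H 2 2 2 x) * T 2 \<beta> \<gamma> x
      + real CARD('n) * ((T 1 1 1 x + T 2 2 1 x) * T 1 \<beta> \<gamma> x + (T 1 1 2 x + T 2 2 2 x) * T 2 \<beta> \<gamma> x)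
      - 2 * TT \<beta> \<gamma> x"
    unfolding TT_def sum_2 by (simp add: algebra_simps)
  also have "\<dots> = d1L 1 x * T 1 \<beta> \<gamma> x + d1L 2 x * T 2 \<beta> \<gamma> x - 2 * TT \<beta> \<gamma> x"
    unfolding T_trace[OF x] trace_H[OF x] by simp
  finally have 2: "(\<Sum>\<alpha>\<in>UNIV. \<Sum>\<epsilon>\<in>UNIV. (H \<alpha> \<alpha> \<epsilon> x + real CARD('n) * T \<alpha> \<alpha> \<epsilon> x) * T \<epsilon> \<beta> \<gamma> x
          - 2 * T \<alpha> \<beta> \<epsilon> x * T \<epsilon> \<alpha> \<gamma> x) = d1L 1 x * T 1 \<beta> \<gamma> x + d1L 2 x * T 2 \<beta> \<gamma> x - 2 * TT \<beta> \<gamma> x" .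
  show ?thesis
    unfolding ricci_fibre[OF p] x_def[symmetric] 1 2 by (simp add: algebra_simps)
qed

text \<open>The coefficient of \<open>TT\<close> collects 2 from \<open>div_H\<close>, -1 from
  \<open>H_contraction\<close> and \<open>- CARD('n)\<close> from the fibres. The terms linear in
  the derivatives of \<open>L\<close> cancel between the first two.\<close>

lemma ricci_base_eq:
  assumes p: "p \<in> total_domain U"
  defines "x \<equiv> base_point p"
  shows "ricci G (None, \<gamma>) (None, \<beta>) p = (1 - real CARD('n)) * TT \<beta> \<gamma> x
     - (1/2) * g x $ \<beta> $ \<gamma> * (\<Sum>\<alpha>\<in>UNIV. \<Sum>\<beta>\<in>UNIV. gi \<alpha> \<beta> x * d2L \<alpha> \<beta> x)"
proof -
  have x: "x \<in> U"
    using p by (simp add: total_domain_def x_def)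
  have 1: "(\<Sum>\<alpha>\<in>UNIV. partial_deriv \<alpha> (H \<alpha> \<beta> \<gamma>) x - partial_deriv \<beta> (H \<alpha> \<alpha> \<gamma>) x - real CARD('n) * partial_deriv \<beta> (T \<alpha> \<alpha> \<gamma>) x)
     = (\<Sum>\<alpha>\<in>UNIV. dH \<alpha> \<alpha> \<beta> \<gamma> x) - d2L \<beta> \<gamma> x"
    unfolding sum_subtractf partial_trace_H[OF x] sum_distrib_left[symmetric] partial_trace_T[OF x]
    unfolding partial_deriv_eqI[OF has_partial_H[OF x]] by simp
  have "(\<Sum>\<alpha>\<in>UNIV. \<Sum>\<epsilon>\<in>UNIV. (H \<alpha> \<alpha> \<epsilon> x + real CARD('n) * T \<alpha> \<alpha> \<epsilon> x) * H \<epsilon> \<beta> \<gamma> x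
          - H \<alpha> \<beta> \<epsilon> x * H \<epsilon> \<alpha> \<gamma> x - real CARD('n) * (T \<alpha> \<beta> \<epsilon> x * T \<epsilon> \<alpha> \<gamma> x))
      = (H 1 1 1 x + H 2 2 1 x) * H 1 \<beta> \<gamma> x + (H 1 1 2 x + H 2 2 2 x) * H 2 \<beta> \<gamma> x
      + real CARD('n) * ((T 1 1 1 x + T 2 2 1 x) * H 1 \<beta> \<gamma> x + (T 1 1 2 x + T 2 2 2 x) * H 2 \<beta> \<gamma> x)
      - (\<Sum>\<alpha>\<in>UNIV. \<Sum>\<epsilon>\<in>UNIV. H \<alpha> \<beta> \<epsilon> x * H \<epsilon> \<alpha> \<gamma> x) - real CARD('n) * TT \<beta> \<gamma> x"
    unfolding TT_def sum_2 by (simp add: algebra_simps)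
  also have "\<dots> = d1L 1 x * T 1 \<beta> \<gamma> x + d1L 2 x * T 2 \<beta> \<gamma> x - TT \<beta> \<gamma> x - real CARD('n) * TT \<beta> \<gamma> x"
    unfolding T_trace[OF x] trace_H[OF x] H_contraction[OF x, symmetric] by simp
  finally show ?thesis
    unfolding ricci_base[OF p] x_def[symmetric] 1 div_H[OF x] by (simp add: algebra_simps)
qed

text \<open>By \<open>TT_proportional\<close> every base component is
  \<open>g \<beta> \<gamma>\<close> times one scalar, so a single equation for the Laplacian of
  \<open>L\<close> suffices. The hypothesis \<open>laplace\<close> is that equation multiplied by
  \<open>D\<close> and by \<open>g11\<close>; its last factor is
  \<open>2 * D * TT 1 1\<close>.\<close>

lemma ricci_flat:
  assumes pos: "\<And>x. x \<in> U \<Longrightarrow> g x $ 1 $ 1 \<noteq> 0"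
    and laplace: "\<And>x. x \<in> U \<Longrightarrow>
      g x $ 1 $ 1 * (g x $ 2 $ 2 * d2L 1 1 x - 2 * g x $ 1 $ 2 * d2L 1 2 x + g x $ 1 $ 1 * d2L 2 2 x)
       = - (real CARD('n) - 1) * ((u 1 1 2 x)\<^sup>2 - u 1 1 1 x * u 1 2 2 x)"
  shows "ricci_flat_on (total_domain U) G"
proof -
  have base: "ricci G (None, \<gamma>) (None, \<beta>) p = 0" if p: "p \<in> total_domain U" for p \<beta> \<gamma>
  proof -
    define x where "x = base_point p"
    have x: "x \<in> U"
      using p by (simp add: total_domain_def x_def)
    let ?Lap = "\<Sum>\<alpha>\<in>UNIV. \<Sum>\<beta>\<in>UNIV. gi \<alpha> \<beta> x * d2L \<alpha> \<beta> x"
    have DLap: "D * ?Lap = g x $ 2 $ 2 * d2L 1 1 x - 2 * g x $ 1 $ 2 * d2L 1 2 x + g x $ 1 $ 1 * d2L 2 2 x"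
      using D_nz by (simp add: sum_2 gi_def d2L_sym[OF x, of 2 1] field_simps)
    have DTT: "D * (2 * TT 1 1 x) = (u 1 1 2 x)\<^sup>2 - u 1 1 1 x * u 1 2 2 x"
      using D_nz unfolding TT_eq[OF x] by (simp add: power2_eq_square)
    have "D * (g x $ 1 $ 1 * ?Lap) = g x $ 1 $ 1 * (D * ?Lap)"
      by (rule mult.left_commute)
    also have "\<dots> = - (real CARD('n) - 1) * (D * (2 * TT 1 1 x))"
      unfolding DLap DTT by (rule laplace[OF x])
    also have "\<dots> = D * (- (real CARD('n) - 1) * (2 * TT 1 1 x))"
      by (rule mult.left_commute)
    finally have Lap: "g x $ 1 $ 1 * ?Lap = - (real CARD('n) - 1) * (2 * TT 1 1 x)"
      using D_nz by simp
    have "g x $ 1 $ 1 * ricci G (None, \<gamma>) (None, \<beta>) p =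
       (1 - real CARD('n)) * (g x $ 1 $ 1 * TT \<beta> \<gamma> x) - (1/2) * g x $ \<beta> $ \<gamma> * (g x $ 1 $ 1 * ?Lap)"
      unfolding ricci_base_eq[OF p] x_def[symmetric] by (simp add: algebra_simps)
    also have "\<dots> = 0"
      unfolding Lap TT_proportional[OF x] by (simp add: algebra_simps)
    finally show ?thesis
      using pos[OF x] by simp
  qed
  have "ricci G a b p = 0" if "p \<in> total_domain U" for p a b
    by (cases a; cases b; cases "fst a"; cases "fst b")
       (use that base ricci_mixed ricci_fibre_eq_0 in auto)
  then show ?thesis
    by (simp add: ricci_flat_on_def)
qed

end

section \<open>Minimal graphs give Hessian metrics\<close>

lemma matrix_inv_2:
  fixes M :: "real ^ 2 ^ 2"
  assumes "det M \<noteq> 0"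
  shows "matrix_inv M $ 1 $ 1 = M $ 2 $ 2 / det M" "matrix_inv M $ 1 $ 2 = - M $ 1 $ 2 / det M"
    "matrix_inv M $ 2 $ 1 = - M $ 2 $ 1 / det M" "matrix_inv M $ 2 $ 2 = M $ 1 $ 1 / det M"
proof -
  let ?B = "\<chi> i j. (if i = j then (if i = 1 then M $ 2 $ 2 else M $ 1 $ 1) else - M $ i $ j) / det M"
  have d: "M $ 1 $ 1 * M $ 2 $ 2 - M $ 1 $ 2 * M $ 2 $ 1 = det M"
    by (simp add: det_2)
  have "M ** ?B = mat 1"
    using assms
    by (simp add: vec_eq_iff matrix_matrix_mult_def mat_def forall_2 sum_2 d mult.commute flip: diff_divide_distrib)
  then have "matrix_inv M = ?B"
    by (rule matrix_inv_eqI)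
  then show "matrix_inv M $ 1 $ 1 = M $ 2 $ 2 / det M" "matrix_inv M $ 1 $ 2 = - M $ 1 $ 2 / det M"
    "matrix_inv M $ 2 $ 1 = - M $ 2 $ 1 / det M" "matrix_inv M $ 2 $ 2 = M $ 1 $ 1 / det M"
    by simp_all
qed

text \<open>\<open>p, q\<close> are the first and \<open>r, s, t\<close> the second derivatives of
  the graph function; \<open>R\<close> is the determinant of the induced metric, with derivatives
  \<open>R1, R2\<close>. In each equation the difference of the two sides is a polynomial multiple
  of the minimal surface expression, so minimality gives the Codazzi conditions.\<close>

lemma codazzi_identity:
  fixes k0 k1 k2 \<epsilon> p q r s t :: real
  assumes "(k2 + \<epsilon> * q\<^sup>2) * r - 2 * (k0 + \<epsilon> * p * q) * s + (k1 + \<epsilon> * p\<^sup>2) * t = 0"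
  defines "R \<equiv> k1 * k2 - k0\<^sup>2 + \<epsilon> * (k2 * p\<^sup>2 - 2 * k0 * p * q + k1 * q\<^sup>2)"
    and "R1 \<equiv> 2 * \<epsilon> * (k2 * p * r - k0 * (r * q + p * s) + k1 * q * s)"
    and "R2 \<equiv> 2 * \<epsilon> * (k2 * p * s - k0 * (s * q + p * t) + k1 * q * t)"
  shows "R * (\<epsilon> * (s * p + p * s)) - (1/2) * R2 * (k1 + \<epsilon> * p * p)
       = R * (\<epsilon> * (r * q + p * s)) - (1/2) * R1 * (k0 + \<epsilon> * p * q)"
    "R * (\<epsilon> * (s * q + q * s)) - (1/2) * R1 * (k2 + \<epsilon> * q * q)
       = R * (\<epsilon> * (s * q + p * t)) - (1/2) * R2 * (k0 + \<epsilon> * p * q)"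
proof -
  let ?M = "(k2 + \<epsilon> * q\<^sup>2) * r - 2 * (k0 + \<epsilon> * p * q) * s + (k1 + \<epsilon> * p\<^sup>2) * t"
  have "R * (\<epsilon> * (s * p + p * s)) - (1/2) * R2 * (k1 + \<epsilon> * p * p)
       - (R * (\<epsilon> * (r * q + p * s)) - (1/2) * R1 * (k0 + \<epsilon> * p * q)) = \<epsilon> * (k0 * p - k1 * q) * ?M"
    unfolding R_def R1_def R2_def by algebra
  then show "R * (\<epsilon> * (s * p + p * s)) - (1/2) * R2 * (k1 + \<epsilon> * p * p)
       = R * (\<epsilon> * (r * q + p * s)) - (1/2) * R1 * (k0 + \<epsilon> * p * q)"
    unfolding assms(1) by simp
  have "R * (\<epsilon> * (s * q + q * s)) - (1/2) * R1 * (k2 + \<epsilon> * q * q)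
       - (R * (\<epsilon> * (s * q + p * t)) - (1/2) * R2 * (k0 + \<epsilon> * p * q)) = \<epsilon> * (k0 * q - k2 * p) * ?M"
    unfolding R_def R1_def R2_def by algebra
  then show "R * (\<epsilon> * (s * q + q * s)) - (1/2) * R1 * (k2 + \<epsilon> * q * q)
       = R * (\<epsilon> * (s * q + p * t)) - (1/2) * R2 * (k0 + \<epsilon> * p * q)"
    unfolding assms(1) by simp
qed

locale minimal_graph =
  fixes \<epsilon> :: real and g0 :: "real ^ 2 ^ 2" and U :: "(real ^ 2) set" and \<phi> :: "real ^ 2 \<Rightarrow> real"
  assumes g0_sym: "transpose g0 = g0" and g0_inv: "invertible g0"
    and open_U: "open U" and smooth_phi: "smooth_on U \<phi>" and minimal: "minimal_graph_on U g0 \<epsilon> \<phi>"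
    and rho_pos: "\<And>x. x \<in> U \<Longrightarrow> graph_rho g0 \<epsilon> \<phi> x > 0"
begin

abbreviation "\<rho> \<equiv> graph_rho g0 \<epsilon> \<phi>"
abbreviation "g \<equiv> rescaled_metric g0 \<epsilon> \<phi>"
abbreviation "d1 \<alpha> \<equiv> partial_deriv \<alpha> \<phi>"
abbreviation "d2 \<alpha> \<beta> \<equiv> partial_deriv \<alpha> (partial_deriv \<beta> \<phi>)"

lemma g0_21: "g0 $ 2 $ 1 = g0 $ 1 $ 2"
proof -
  have "transpose g0 $ 1 $ 2 = g0 $ 1 $ 2"
    by (simp only: g0_sym)
  then show ?thesis
    by (simp add: transpose_def)
qed

lemma det_g0: "det g0 = g0 $ 1 $ 1 * g0 $ 2 $ 2 - (g0 $ 1 $ 2)\<^sup>2"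
  by (simp add: det_2 g0_21 power2_eq_square)

lemma det_g0_nz: "det g0 \<noteq> 0"
  using g0_inv invertible_det_nz by blast

lemma rho_explicit:
  "\<rho> x = 1 + \<epsilon> * (g0 $ 2 $ 2 * (d1 1 x)\<^sup>2 - 2 * g0 $ 1 $ 2 * d1 1 x * d1 2 x + g0 $ 1 $ 1 * (d1 2 x)\<^sup>2) / det g0"
  unfolding graph_rho_def sum_2 matrix_inv_2[OF det_g0_nz] g0_21
  using det_g0_nz by (simp add: field_simps power2_eq_square)

text \<open>By the matrix determinant lemma both sides are the determinant of the induced metric.
  This form avoids the inverse of \<open>g0\<close>.\<close>

lemma det_g0_rho:
  "det g0 * \<rho> x = det g0 + \<epsilon> * (g0 $ 2 $ 2 * (d1 1 x)\<^sup>2 - 2 * g0 $ 1 $ 2 * d1 1 x * d1 2 x + g0 $ 1 $ 1 * (d1 2 x)\<^sup>2)"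
  unfolding rho_explicit using det_g0_nz by (simp add: field_simps)

lemma g_explicit: "g x $ \<alpha> $ \<beta> = \<rho> x powr (-1/2) * (g0 $ \<alpha> $ \<beta> + \<epsilon> * d1 \<alpha> x * d1 \<beta> x)"
  by (simp add: rescaled_metric_def induced_metric_def)

lemma g_21: "g x $ 2 $ 1 = g x $ 1 $ 2"
  by (simp add: g_explicit g0_21)

lemma smooth_gen_d1: "smooth_gen U (d1 \<alpha>)"
  by (intro smooth_gen.base smooth_on_partial_deriv smooth_phi)

lemma smooth_rho: "smooth_gen U \<rho>"
proof -
  have eq: "\<rho> = (\<lambda>x. 1 + \<epsilon> / det g0 * (g0 $ 2 $ 2 * (d1 1 x * d1 1 x) + (- 2 * g0 $ 1 $ 2) * (d1 1 x * d1 2 x) + g0 $ 1 $ 1 * (d1 2 x * d1 2 x)))"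
    by (rule ext) (simp add: rho_explicit power2_eq_square)
  show ?thesis
    unfolding eq
    by (intro smooth_gen.add smooth_gen.mult smooth_gen_d1 smooth_gen.base[OF smooth_on_const])
qed

lemma smooth_g: "smooth_gen U (\<lambda>x. g x $ \<alpha> $ \<beta>)"
  unfolding g_explicit mult.assoc
  by (intro smooth_gen.add smooth_gen.mult smooth_gen.powr smooth_rho smooth_gen_d1 rho_pos smooth_gen.base[OF smooth_on_const])

context
  fixes x assumes x: "x \<in> U"
begin

text \<open>In dimension two, scaling by the power -1/2 of \<open>\<rho>\<close> divides the
  determinant by \<open>\<rho>\<close>, which is exactly the excess of the induced determinant over
  that of \<open>g0\<close>.\<close>

lemma det_g_eq: "g x $ 1 $ 1 * g x $ 2 $ 2 - (g x $ 1 $ 2)\<^sup>2 = det g0"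
proof -
  let ?a = "\<lambda>\<alpha> \<beta>. g0 $ \<alpha> $ \<beta> + \<epsilon> * d1 \<alpha> x * d1 \<beta> x"
  have "det g0 * \<rho> x = det g0 + \<epsilon> * (g0 $ 2 $ 2 * (d1 1 x)\<^sup>2 - 2 * g0 $ 1 $ 2 * d1 1 x * d1 2 x + g0 $ 1 $ 1 * (d1 2 x)\<^sup>2)"
    by (rule det_g0_rho)
  also have "\<dots> = ?a 1 1 * ?a 2 2 - (?a 1 2)\<^sup>2"
    unfolding det_g0 by (simp add: power2_eq_square algebra_simps)
  finally have "?a 1 1 * ?a 2 2 - (?a 1 2)\<^sup>2 = det g0 * \<rho> x" ..
  moreover have r: "\<rho> x powr (-1/2) * \<rho> x powr (-1/2) = 1 / \<rho> x"
    using rho_pos[OF x] by (simp add: powr_minus_divide flip: powr_add)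
  have "g x $ 1 $ 1 * g x $ 2 $ 2 - (g x $ 1 $ 2)\<^sup>2
      = (\<rho> x powr (-1/2) * \<rho> x powr (-1/2)) * (?a 1 1 * ?a 2 2 - (?a 1 2)\<^sup>2)"
    unfolding g_explicit by (simp only: power2_eq_square algebra_simps)
  ultimately show ?thesis
    unfolding r using rho_pos[OF x] by simp
qed

lemma has_partial_d1: "((\<lambda>t. d1 \<alpha> (x + t *\<^sub>R axis \<mu> 1)) has_real_derivative d2 \<mu> \<alpha> x) (at 0)"
  by (rule smooth_gen_has_partial_deriv[OF smooth_gen_d1 x])

lemma d2_sym: "d2 1 2 x = d2 2 1 x"
  by (rule smooth_on_partial_deriv_commute[OF open_U smooth_phi x])

lemma minimal_eq:
  "(g0 $ 2 $ 2 + \<epsilon> * (d1 2 x)\<^sup>2) * d2 1 1 x - 2 * (g0 $ 1 $ 2 + \<epsilon> * d1 1 x * d1 2 x) * d2 2 1 x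
     + (g0 $ 1 $ 1 + \<epsilon> * (d1 1 x)\<^sup>2) * d2 2 2 x = 0"
  using minimal x by (simp add: minimal_graph_on_def)

text \<open>The left side is \<open>det g0\<close> times the Laplacian of \<open>\<phi>\<close>,
  whose first-order terms are absent because the coordinates are harmonic.\<close>

lemma phi_harmonic:
  "g x $ 2 $ 2 * d2 1 1 x - 2 * g x $ 1 $ 2 * d2 1 2 x + g x $ 1 $ 1 * d2 2 2 x = 0"
proof -
  have "g x $ 2 $ 2 * d2 1 1 x - 2 * g x $ 1 $ 2 * d2 1 2 x + g x $ 1 $ 1 * d2 2 2 x =
    \<rho> x powr (-1/2) * ((g0 $ 2 $ 2 + \<epsilon> * (d1 2 x)\<^sup>2) * d2 1 1 x - 2 * (g0 $ 1 $ 2 + \<epsilon> * d1 1 x * d1 2 x) * d2 2 1 x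
     + (g0 $ 1 $ 1 + \<epsilon> * (d1 1 x)\<^sup>2) * d2 2 2 x)"
    unfolding g_explicit d2_sym by (simp only: power2_eq_square algebra_simps)
  then show ?thesis
    unfolding minimal_eq by simp
qed

lemma det_g0_partial_rho:
  "det g0 * partial_deriv \<mu> \<rho> x = 2 * \<epsilon> * (g0 $ 2 $ 2 * d1 1 x * d2 \<mu> 1 x
      - g0 $ 1 $ 2 * (d2 \<mu> 1 x * d1 2 x + d1 1 x * d2 \<mu> 2 x) + g0 $ 1 $ 1 * d1 2 x * d2 \<mu> 2 x)"
proof -
  have "det g0 * partial_deriv \<mu> \<rho> x = partial_deriv \<mu> (\<lambda>x. det g0 * \<rho> x) x"
    by (rule partial_deriv_eqI[symmetric]) (rule DERIV_cmult[OF smooth_gen_has_partial_deriv[OF smooth_rho x]])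
  also have "\<dots> = 2 * \<epsilon> * (g0 $ 2 $ 2 * d1 1 x * d2 \<mu> 1 x
      - g0 $ 1 $ 2 * (d2 \<mu> 1 x * d1 2 x + d1 1 x * d2 \<mu> 2 x) + g0 $ 1 $ 1 * d1 2 x * d2 \<mu> 2 x)"
    by (rule partial_deriv_eqI, unfold det_g0_rho)
       (auto intro!: derivative_eq_intros has_partial_d1 simp: algebra_simps)
  finally show ?thesis .
qed

text \<open>The power -3/2 of \<open>\<rho>\<close> is common to all these derivatives, so comparing
  two of them reduces to the polynomial brackets.\<close>

lemma partial_g:
  "partial_deriv \<mu> (\<lambda>x. g x $ \<alpha> $ \<beta>) x = \<rho> x powr (-3/2) *
     (\<rho> x * (\<epsilon> * (d2 \<mu> \<alpha> x * d1 \<beta> x + d1 \<alpha> x * d2 \<mu> \<beta> x))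
       - (1/2) * partial_deriv \<mu> \<rho> x * (g0 $ \<alpha> $ \<beta> + \<epsilon> * d1 \<alpha> x * d1 \<beta> x))"
proof (rule partial_deriv_eqI)
  have r: "\<rho> x powr (-1/2) = \<rho> x powr (-3/2) * \<rho> x"
  proof -
    have "\<rho> x powr (-3/2) * \<rho> x powr 1 = \<rho> x powr (-1/2)"
      unfolding powr_add[symmetric] by simp
    then show ?thesis using rho_pos[OF x] by simp
  qed
  have pw: "((\<lambda>t. \<rho> (x + t *\<^sub>R axis \<mu> 1) powr (-1/2)) has_real_derivative
      (-1/2) * \<rho> x powr (-3/2) * partial_deriv \<mu> \<rho> x) (at 0)"
    using DERIV_chain2[OF has_real_derivative_powr[of "\<rho> (x + 0 *\<^sub>R axis \<mu> 1)" "-1/2"]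
          smooth_gen_has_partial_deriv[OF smooth_rho x, of \<mu>]] rho_pos[OF x] by simp
  have "((\<lambda>t. g (x + t *\<^sub>R axis \<mu> 1) $ \<alpha> $ \<beta>) has_real_derivative
     (-1/2) * \<rho> x powr (-3/2) * partial_deriv \<mu> \<rho> x * (g0 $ \<alpha> $ \<beta> + \<epsilon> * d1 \<alpha> x * d1 \<beta> x)
      + (\<epsilon> * (d2 \<mu> \<alpha> x * d1 \<beta> x + d1 \<alpha> x * d2 \<mu> \<beta> x)) * \<rho> x powr (-1/2)) (at 0)"
    unfolding g_explicit
    by (rule DERIV_cong, (rule pw has_partial_d1 derivative_intros)+) (simp add: algebra_simps)
  then show "((\<lambda>t. g (x + t *\<^sub>R axis \<mu> 1) $ \<alpha> $ \<beta>) has_real_derivative \<rho> x powr (-3/2) *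
     (\<rho> x * (\<epsilon> * (d2 \<mu> \<alpha> x * d1 \<beta> x + d1 \<alpha> x * d2 \<mu> \<beta> x))
       - (1/2) * partial_deriv \<mu> \<rho> x * (g0 $ \<alpha> $ \<beta> + \<epsilon> * d1 \<alpha> x * d1 \<beta> x))) (at 0)"
    by (rule DERIV_cong) (unfold r, simp add: algebra_simps)
qed

lemma codazzi:
  "partial_deriv 2 (\<lambda>x. g x $ 1 $ 1) x = partial_deriv 1 (\<lambda>x. g x $ 1 $ 2) x"
  "partial_deriv 1 (\<lambda>x. g x $ 2 $ 2) x = partial_deriv 2 (\<lambda>x. g x $ 1 $ 2) x"
proof -
  \<comment> \<open>Multiplying by \<open>det g0\<close> turns \<open>\<rho>\<close> and its
    derivatives into the polynomials \<open>R, R1, R2\<close> of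
    \<open>codazzi_identity\<close>.\<close>
  have key: "det g0 * (\<rho> x * (\<epsilon> * (d2 \<mu> \<alpha> x * d1 \<beta> x + d1 \<alpha> x * d2 \<mu> \<beta> x))
       - (1/2) * partial_deriv \<mu> \<rho> x * (g0 $ \<alpha> $ \<beta> + \<epsilon> * d1 \<alpha> x * d1 \<beta> x)) =
     (det g0 * \<rho> x) * (\<epsilon> * (d2 \<mu> \<alpha> x * d1 \<beta> x + d1 \<alpha> x * d2 \<mu> \<beta> x))
       - (1/2) * (det g0 * partial_deriv \<mu> \<rho> x) * (g0 $ \<alpha> $ \<beta> + \<epsilon> * d1 \<alpha> x * d1 \<beta> x)" for \<mu> \<alpha> \<beta>
    by (simp only: algebra_simps)
  have *: "det g0 * (\<rho> x * (\<epsilon> * (d2 2 1 x * d1 1 x + d1 1 x * d2 2 1 x))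
       - (1/2) * partial_deriv 2 \<rho> x * (g0 $ 1 $ 1 + \<epsilon> * d1 1 x * d1 1 x)) =
    det g0 * (\<rho> x * (\<epsilon> * (d2 1 1 x * d1 2 x + d1 1 x * d2 1 2 x))
       - (1/2) * partial_deriv 1 \<rho> x * (g0 $ 1 $ 2 + \<epsilon> * d1 1 x * d1 2 x))"
    "det g0 * (\<rho> x * (\<epsilon> * (d2 1 2 x * d1 2 x + d1 2 x * d2 1 2 x))
       - (1/2) * partial_deriv 1 \<rho> x * (g0 $ 2 $ 2 + \<epsilon> * d1 2 x * d1 2 x)) =
    det g0 * (\<rho> x * (\<epsilon> * (d2 2 1 x * d1 2 x + d1 1 x * d2 2 2 x))
       - (1/2) * partial_deriv 2 \<rho> x * (g0 $ 1 $ 2 + \<epsilon> * d1 1 x * d1 2 x))"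
    unfolding key unfolding det_g0_rho det_g0_partial_rho d2_sym unfolding det_g0
    by (rule codazzi_identity[OF minimal_eq])+
  show "partial_deriv 2 (\<lambda>x. g x $ 1 $ 1) x = partial_deriv 1 (\<lambda>x. g x $ 1 $ 2) x"
    "partial_deriv 1 (\<lambda>x. g x $ 2 $ 2) x = partial_deriv 2 (\<lambda>x. g x $ 1 $ 2) x"
    unfolding partial_g using *[unfolded mult_left_cancel[OF det_g0_nz]] by simp_all
qed

end
end

section \<open>The Laplacian of the conformal exponent\<close>

text \<open>With \<open>v1\<close> to \<open>v5\<close> the second derivatives of \<open>g\<close>,
  ordered by the number of indices equal to 2, the left sides are \<open>g11 * D\<close> times the
  Laplacians of \<open>ln g11\<close> and \<open>ln g22\<close>. Both reduce to the same expression
  by the first and second derivatives of the determinant.\<close>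

lemma laplace_ln_identities:
  fixes a b c p q r s v1 v2 v3 v4 v5 :: real
  assumes "a \<noteq> 0" "c \<noteq> 0"
    and "p * c + a * r - 2 * b * q = 0" "q * c + a * s - 2 * b * r = 0"
    and "v1 * c + a * v3 - 2 * b * v2 = 2 * q * q - p * r - r * p"
    and "v3 * c + a * v5 - 2 * b * v4 = 2 * r * r - q * s - s * q"
  shows "a * (c * ((v1 * a - p * p) / (a * a)) - 2 * b * ((v2 * a - q * p) / (a * a)) + a * ((v3 * a - q * q) / (a * a))) = q\<^sup>2 - p * r"
    "a * (c * ((v3 * c - r * r) / (c * c)) - 2 * b * ((v4 * c - s * r) / (c * c)) + a * ((v5 * c - s * s) / (c * c))) = q\<^sup>2 - p * r"
proof -
  have "a * (c * (v1 * a - p * p) - 2 * b * (v2 * a - q * p) + a * (v3 * a - q * q)) = (q\<^sup>2 - p * r) * (a * a)"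
    using assms(3-) by algebra
  then show "a * (c * ((v1 * a - p * p) / (a * a)) - 2 * b * ((v2 * a - q * p) / (a * a)) + a * ((v3 * a - q * q) / (a * a))) = q\<^sup>2 - p * r"
    unfolding times_divide_eq_right diff_divide_distrib[symmetric] add_divide_distrib[symmetric]
    using assms(1) by simp
  have "a * (c * (v3 * c - r * r) - 2 * b * (v4 * c - s * r) + a * (v5 * c - s * s)) = (q\<^sup>2 - p * r) * (c * c)"
    using assms(3-) by algebra
  then show "a * (c * ((v3 * c - r * r) / (c * c)) - 2 * b * ((v4 * c - s * r) / (c * c)) + a * ((v5 * c - s * s) / (c * c))) = q\<^sup>2 - p * r"
    unfolding times_divide_eq_right diff_divide_distrib[symmetric] add_divide_distrib[symmetric]
    using assms(2) by simp
qed

context minimal_graph begin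

context
  fixes e0 A B :: real
  assumes diag_pos: "\<And>x. x \<in> U \<Longrightarrow> g x $ 1 $ 1 > 0 \<and> g x $ 2 $ 2 > 0"
begin

text \<open>\<open>A\<close> and \<open>B\<close> will be \<open>m1 + n1\<close> and
  \<open>m2 + n2\<close>. The powers of \<open>\<rho>\<close> are absorbed into the diagonal entries
  of \<open>g\<close>, which are those of the induced metric rescaled.\<close>

definition L :: "real ^ 2 \<Rightarrow> real" where
  "L x = 2 * e0 * \<phi> x + (-2 * A) * ln (g x $ 1 $ 1) + (-2 * B) * ln (g x $ 2 $ 2)"

lemma smooth_L: "smooth_on U L"
  unfolding L_def
  by (rule smooth_gen_imp_smooth_on[OF open_U])
     (intro smooth_gen.add smooth_gen.mult smooth_gen.ln smooth_g conjunct1[OF diag_pos] conjunct2[OF diag_pos]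
       smooth_gen.base[OF smooth_on_const] smooth_gen.base[OF smooth_phi])

lemma hessian_metric: "hessian_metric U g L (det g0)"
proof
  show "smooth_on U (\<lambda>x. g x $ \<alpha> $ \<beta>)" for \<alpha> \<beta>
    by (rule smooth_gen_imp_smooth_on[OF open_U smooth_g])
qed (use open_U smooth_L g_21 det_g_eq det_g0_nz codazzi in auto)

interpretation hm: hessian_metric U g L "det g0"
  by (rule hessian_metric)

lemma partial_L:
  assumes x: "x \<in> U"
  shows "partial_deriv \<mu> L x = 2 * e0 * d1 \<mu> x - 2 * A * (hm.u \<mu> 1 1 x / g x $ 1 $ 1) - 2 * B * (hm.u \<mu> 2 2 x / g x $ 2 $ 2)"
proof (rule partial_deriv_eqI)
  have ln: "((\<lambda>t. ln (g (x + t *\<^sub>R axis \<mu> 1) $ \<alpha> $ \<beta>)) has_real_derivative hm.u \<mu> \<alpha> \<beta> x / g x $ \<alpha> $ \<beta>) (at 0)"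
    if "g x $ \<alpha> $ \<beta> > 0" for \<alpha> \<beta>
    using DERIV_chain2[OF DERIV_ln[of "g (x + 0 *\<^sub>R axis \<mu> 1) $ \<alpha> $ \<beta>"] hm.has_partial_g[OF x]] that
    by (simp add: field_simps)
  show "((\<lambda>t. L (x + t *\<^sub>R axis \<mu> 1)) has_real_derivative
      2 * e0 * d1 \<mu> x - 2 * A * (hm.u \<mu> 1 1 x / g x $ 1 $ 1) - 2 * B * (hm.u \<mu> 2 2 x / g x $ 2 $ 2)) (at 0)"
    unfolding L_def
    by (rule DERIV_cong, (rule DERIV_add DERIV_cmult ln conjunct1[OF diag_pos] conjunct2[OF diag_pos] x
          smooth_on_has_partial_deriv[OF smooth_phi])+) simp
qed

lemma partial2_L:
  assumes x: "x \<in> U"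
  shows "hm.d2L \<nu> \<mu> x = 2 * e0 * d2 \<nu> \<mu> x
     - 2 * A * ((hm.v \<nu> \<mu> 1 1 x * g x $ 1 $ 1 - hm.u \<mu> 1 1 x * hm.u \<nu> 1 1 x) / (g x $ 1 $ 1 * g x $ 1 $ 1))
     - 2 * B * ((hm.v \<nu> \<mu> 2 2 x * g x $ 2 $ 2 - hm.u \<mu> 2 2 x * hm.u \<nu> 2 2 x) / (g x $ 2 $ 2 * g x $ 2 $ 2))"
proof -
  have nz: "g x $ 1 $ 1 \<noteq> 0" "g x $ 2 $ 2 \<noteq> 0"
    using diag_pos[OF x] by auto
  have quot: "((\<lambda>t. hm.u \<mu> \<alpha> \<beta> (x + t *\<^sub>R axis \<nu> 1) / g (x + t *\<^sub>R axis \<nu> 1) $ \<alpha> $ \<beta>) has_real_derivative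
      (hm.v \<nu> \<mu> \<alpha> \<beta> x * g x $ \<alpha> $ \<beta> - hm.u \<mu> \<alpha> \<beta> x * hm.u \<nu> \<alpha> \<beta> x) / (g x $ \<alpha> $ \<beta> * g x $ \<alpha> $ \<beta>)) (at 0)"
    if "g x $ \<alpha> $ \<beta> \<noteq> 0" for \<alpha> \<beta>
    using DERIV_divide[OF hm.has_partial_u[OF x, of \<mu> \<alpha> \<beta> \<nu>] hm.has_partial_g[OF x, of \<nu> \<alpha> \<beta>]] that by simp
  have "hm.d2L \<nu> \<mu> x = partial_deriv \<nu> (\<lambda>x. 2 * e0 * d1 \<mu> x - 2 * A * (hm.u \<mu> 1 1 x / g x $ 1 $ 1)
      - 2 * B * (hm.u \<mu> 2 2 x / g x $ 2 $ 2)) x"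
    by (rule partial_deriv_cong[OF open_U x]) (rule partial_L)
  also have "\<dots> = 2 * e0 * d2 \<nu> \<mu> x
     - 2 * A * ((hm.v \<nu> \<mu> 1 1 x * g x $ 1 $ 1 - hm.u \<mu> 1 1 x * hm.u \<nu> 1 1 x) / (g x $ 1 $ 1 * g x $ 1 $ 1))
     - 2 * B * ((hm.v \<nu> \<mu> 2 2 x * g x $ 2 $ 2 - hm.u \<mu> 2 2 x * hm.u \<nu> 2 2 x) / (g x $ 2 $ 2 * g x $ 2 $ 2))"
    by (rule partial_deriv_eqI) (rule DERIV_diff DERIV_cmult quot nz has_partial_d1[OF x])+
  finally show ?thesis .
qed

text \<open>The term with \<open>\<phi>\<close> drops out by \<open>phi_harmonic\<close>. Both
  logarithms have the same Laplacian, so only the sum \<open>A + B\<close> survives.\<close>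

lemma laplace_L:
  assumes x: "x \<in> U"
  shows "g x $ 1 $ 1 * (g x $ 2 $ 2 * hm.d2L 1 1 x - 2 * g x $ 1 $ 2 * hm.d2L 1 2 x + g x $ 1 $ 1 * hm.d2L 2 2 x)
       = - (2 * (A + B)) * ((hm.u 1 1 2 x)\<^sup>2 - hm.u 1 1 1 x * hm.u 1 2 2 x)"
proof -
  let ?a = "g x $ 1 $ 1" and ?b = "g x $ 1 $ 2" and ?c = "g x $ 2 $ 2"
  have nz: "?a \<noteq> 0" "?c \<noteq> 0"
    using diag_pos[OF x] by auto
  let ?W = "(hm.u 1 1 2 x)\<^sup>2 - hm.u 1 1 1 x * hm.u 1 2 2 x"
  let ?Q = "\<lambda>\<alpha> \<nu> \<mu>. (hm.v \<nu> \<mu> \<alpha> \<alpha> x * g x $ \<alpha> $ \<alpha> - hm.u \<mu> \<alpha> \<alpha> x * hm.u \<nu> \<alpha> \<alpha> x) / (g x $ \<alpha> $ \<alpha> * g x $ \<alpha> $ \<alpha>)"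
  have Q: "?a * (?c * ?Q \<alpha> 1 1 - 2 * ?b * ?Q \<alpha> 1 2 + ?a * ?Q \<alpha> 2 2) = ?W" for \<alpha>
    using laplace_ln_identities[OF nz hm.det_deriv[OF x, of 1] hm.det_deriv[OF x, of 2, unfolded hm.u_canon[OF x]]
        hm.det_deriv2[OF x, of 1 1, unfolded hm.u_canon[OF x] hm.v_canon[OF x]]
        hm.det_deriv2[OF x, of 2 2, unfolded hm.u_canon[OF x] hm.v_canon[OF x]]]
      exhaust_2[of \<alpha>]
    by (elim disjE) (simp_all only: hm.u_canon[OF x] hm.v_canon[OF x])
  have "?a * (?c * hm.d2L 1 1 x - 2 * ?b * hm.d2L 1 2 x + ?a * hm.d2L 2 2 x) =
     2 * e0 * ?a * (?c * d2 1 1 x - 2 * ?b * d2 1 2 x + ?a * d2 2 2 x)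
      - 2 * A * (?a * (?c * ?Q 1 1 1 - 2 * ?b * ?Q 1 1 2 + ?a * ?Q 1 2 2))
      - 2 * B * (?a * (?c * ?Q 2 1 1 - 2 * ?b * ?Q 2 1 2 + ?a * ?Q 2 2 2))"
  proof -
    have "a * (c * (2 * e0 * d11 - 2 * A * A11 - 2 * B * B11) - 2 * b * (2 * e0 * d12 - 2 * A * A12 - 2 * B * B12)
        + a * (2 * e0 * d22 - 2 * A * A22 - 2 * B * B22)) =
        2 * e0 * a * (c * d11 - 2 * b * d12 + a * d22) - 2 * A * (a * (c * A11 - 2 * b * A12 + a * A22))
          - 2 * B * (a * (c * B11 - 2 * b * B12 + a * B22))"
      for a b c d11 d12 d22 A11 A12 A22 B11 B12 B22 :: real
      by algebra
    then show ?thesis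
      unfolding partial2_L[OF x] .
  qed
  also have "\<dots> = - (2 * (A + B)) * ?W"
    unfolding Q phi_harmonic[OF x] by (simp add: algebra_simps)
  finally show ?thesis .
qed

theorem total_metric_ricci_flat:
  fixes \<epsilon>s :: "'n::finite \<Rightarrow> real" and \<Phi> :: "real ^ 2 \<Rightarrow> real"
  assumes \<epsilon>s: "\<And>i. \<epsilon>s i \<in> {1, -1}" and AB: "A + B = (real CARD('n) - 1) / 2"
    and \<Phi>: "\<And>x. x \<in> U \<Longrightarrow> 2 * \<Phi> x = L x"
  shows "pseudo_riemannian_metric_on (total_domain U) (total_metric \<Phi> g \<epsilon>s)"
    and "ricci_flat_on (total_domain U) (total_metric \<Phi> g \<epsilon>s)"
proof -
  interpret bm: block_metric U g L "det g0" \<Phi> \<epsilon>s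
  proof
    show "\<epsilon>s i * \<epsilon>s i = 1" for i
      using \<epsilon>s[of i] by auto
  qed (rule \<Phi>)
  show "ricci_flat_on (total_domain U) (total_metric \<Phi> g \<epsilon>s)"
  proof (rule bm.ricci_flat)
    show "g x $ 1 $ 1 \<noteq> 0" if "x \<in> U" for x
      using diag_pos[OF that] by simp
    \<comment> \<open>This is where the condition on the exponents enters: it matches the Laplacian
      of \<open>L\<close> with the contribution of the fibres.\<close>
    have "2 * (A + B) = real CARD('n) - 1"
      using AB by simp
    then show "g x $ 1 $ 1 * (g x $ 2 $ 2 * hm.d2L 1 1 x - 2 * g x $ 1 $ 2 * hm.d2L 1 2 x + g x $ 1 $ 1 * hm.d2L 2 2 x)
       = - (real CARD('n) - 1) * ((hm.u 1 1 2 x)\<^sup>2 - hm.u 1 1 1 x * hm.u 1 2 2 x)" if "x \<in> U" for x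
      using laplace_L[OF that] by simp
  qed
  have smooth: "smooth_on (total_domain U) (\<lambda>p. total_metric \<Phi> g \<epsilon>s p $ a $ b)" for a b
  \<comment> \<open>Over \<open>U\<close> the factor \<open>exp (2 * \<Phi>)\<close> equals
    \<open>exp L\<close>, so smoothness is inherited from \<open>L\<close>.\<close>
  proof (rule smooth_on_cong[OF open_total_domain[OF open_U]])
    define f where "f x = (if fst a = fst b then (case fst a of None \<Rightarrow> exp (L x) | Some i \<Rightarrow> \<epsilon>s i)
            * g x $ snd a $ snd b else 0)" for x
    show "total_metric \<Phi> g \<epsilon>s p $ a $ b = f (base_point p)" if "p \<in> total_domain U" for p
      using bm.G_comp[OF that] by (simp add: f_def)
    have "smooth_gen U f"
    proof (cases "fst a = fst b")
      case True
      have "smooth_gen U (\<lambda>x. case fst a of None \<Rightarrow> exp (L x) | Some i \<Rightarrow> \<epsilon>s i)"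
        by (cases "fst a")
           (auto intro: smooth_gen.exp smooth_gen.base smooth_L smooth_on_const)
      then show ?thesis
        unfolding f_def using True by (simp add: smooth_gen.mult smooth_g cong: option.case_cong)
    next
      case False
      then show ?thesis
        unfolding f_def by (simp add: smooth_gen.base smooth_on_const)
    qed
    then show "smooth_on (total_domain U) (\<lambda>p. f (base_point p))"
      by (intro smooth_on_base_point open_U smooth_gen_imp_smooth_on)
  qed
  have "transpose (total_metric \<Phi> g \<epsilon>s p) = total_metric \<Phi> g \<epsilon>s p" if "p \<in> total_domain U" for p
  proof -
    have "total_metric \<Phi> g \<epsilon>s p $ b $ a = total_metric \<Phi> g \<epsilon>s p $ a $ b" for a b
      unfolding bm.G_comp[OF that] hm.g_sym[of _ "snd b" "snd a"] by simp
    then show ?thesis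
      by (simp add: vec_eq_iff transpose_def)
  qed
  then show "pseudo_riemannian_metric_on (total_domain U) (total_metric \<Phi> g \<epsilon>s)"
    unfolding pseudo_riemannian_metric_on_def using smooth matrix_inv_eqI(1)[OF bm.G_Gi] by blast
qed

end
end

section \<open>Reduction of the given exponents to \<open>L\<close>\<close>

text \<open>Taking logarithms and passing from \<open>w\<close> to \<open>r powr (-1/2) * w\<close>
  produces \<open>m1 + n1 + m2 + n2\<close> times \<open>ln r\<close>. Since
  \<open>m1 + m2 = 0\<close>, this is the power of \<open>r\<close> present in the definition of the
  conformal factor.\<close>

lemma twice_Phi_eq:
  fixes P w1 w2 r :: real
  assumes pos: "r > 0" "w1 > 0" "w2 > 0" and m: "m1 + m2 = 0"
    and Psi: "exp (2 * S) = exp (2 * e0 * f) * w1 powr (-2 * m1) * w2 powr (-2 * m2)"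
    and Phi: "exp (2 * P) = exp (2 * S) * w1 powr (-2 * n1) * w2 powr (-2 * n2) * r powr (n1 + n2)"
  shows "2 * P = 2 * e0 * f + (-2 * (m1 + n1)) * ln (r powr (-1/2) * w1) + (-2 * (m2 + n2)) * ln (r powr (-1/2) * w2)"
proof -
  have "exp (2 * P) = exp (2 * e0 * f - 2 * m1 * ln w1 - 2 * m2 * ln w2 - 2 * n1 * ln w1 - 2 * n2 * ln w2 + (n1 + n2) * ln r)"
    unfolding Phi Psi using pos by (simp add: powr_def exp_diff exp_add exp_minus field_simps)
  then have "2 * P = 2 * e0 * f - 2 * m1 * ln w1 - 2 * m2 * ln w2 - 2 * n1 * ln w1 - 2 * n2 * ln w2 + (n1 + n2) * ln r"
    by (rule exp_inj_iff[THEN iffD1])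
  moreover have ln_w: "ln (r powr (-1/2) * w) = ln w - (1/2) * ln r" if "w > 0" for w
    using pos that by (simp add: ln_mult ln_powr)
  moreover have "m2 = - m1"
    using m by simp
  ultimately show ?thesis
    unfolding ln_w[OF pos(2)] ln_w[OF pos(3)] by (simp add: algebra_simps)
qed

theorem mainTheorem1:
  fixes \<epsilon> :: real
    and g0 :: "real ^ 2 ^ 2"
    and U :: "(real ^ 2) set"
    and \<phi> \<psi> \<Phi> :: "real ^ 2 \<Rightarrow> real"
    and \<epsilon>s :: "'n::finite \<Rightarrow> real"
    and e0 m1 m2 n1 n2 :: real
  defines "\<rho> \<equiv> graph_rho g0 \<epsilon> \<phi>"
    and "g \<equiv> rescaled_metric g0 \<epsilon> \<phi>"
    and "w1 \<equiv> graph_w g0 \<epsilon> \<phi> 1"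
    and "w2 \<equiv> graph_w g0 \<epsilon> \<phi> 2"
  assumes "\<epsilon> \<in> {1, -1}"
    and "transpose g0 = g0" and "invertible g0"
    and "open U" and "smooth_on U \<phi>"
    and "minimal_graph_on U g0 \<epsilon> \<phi>"
    and "\<forall>x\<in>U. \<rho> x > 0 \<and> w1 x > 0 \<and> w2 x > 0"
    and "\<forall>i. \<epsilon>s i \<in> {1, -1}"
    and "m1 + m2 = 0"
    and "n1 + n2 = (real CARD('n) - 1) / 2"
    and "\<forall>x\<in>U. exp (2 * \<psi> x) =
           exp (2 * e0 * \<phi> x) * w1 x powr (-2 * m1) * w2 x powr (-2 * m2)"
    and "\<forall>x\<in>U. exp (2 * \<Phi> x) =
           exp (2 * \<psi> x) * w1 x powr (-2 * n1) * w2 x powr (-2 * n2) * \<rho> x powr (n1 + n2)"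
  shows "pseudo_riemannian_metric_on (total_domain U) (total_metric \<Phi> g \<epsilon>s) \<and>
         ricci_flat_on (total_domain U) (total_metric \<Phi> g \<epsilon>s)"
proof -
  interpret mg: minimal_graph \<epsilon> g0 U \<phi>
    by standard (use assms in auto)
  have diag: "g x $ 1 $ 1 = \<rho> x powr (-1/2) * w1 x" "g x $ 2 $ 2 = \<rho> x powr (-1/2) * w2 x" for x
    unfolding g_def \<rho>_def w1_def w2_def mg.g_explicit graph_w_def
    by (simp_all add: power2_eq_square mult.assoc)
  have diag_pos: "g x $ 1 $ 1 > 0 \<and> g x $ 2 $ 2 > 0" if "x \<in> U" for x
    unfolding diag using assms(11) that by (intro conjI mult_pos_pos) auto
  have L: "mg.L e0 A B x = 2 * e0 * \<phi> x + (-2 * A) * ln (g x $ 1 $ 1) + (-2 * B) * ln (g x $ 2 $ 2)" for A B x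
    unfolding g_def by (rule mg.L_def) (use diag_pos in \<open>simp add: g_def\<close>)
  have \<Phi>: "2 * \<Phi> x = mg.L e0 (m1 + n1) (m2 + n2) x" if "x \<in> U" for x
    unfolding L diag by (rule twice_Phi_eq[where S = "\<psi> x"]) (use assms(11,13,15,16) that in auto)
  have mn: "(m1 + n1) + (m2 + n2) = (real CARD('n) - 1) / 2"
    using assms(13,14) by simp
  have sgn: "\<epsilon>s i \<in> {1, -1}" for i
    using assms(12) by blast
  show ?thesis
    unfolding g_def
    by (intro conjI mg.total_metric_ricci_flat[where A = "m1 + n1" and B = "m2 + n2"])
       (use diag_pos sgn mn \<Phi> in \<open>auto simp: g_def\<close>)
qed

end
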